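(* Let $f(z)=\sum_{m\ge0}f_mz^m$ be the polynomial with $f(0)=0$ and $f(z)-f(z-1)=\frac{d^n}{dz^n}(z^n\zeta(z))$, and let $g(z)=\sum_m g_mz^m$ with $g_m=\frac{f_m}{(m+1)(m+2)\cdots(m+n-1)}$. Then the Casimir element of $H_\zeta(\mathfrak{gl}_n)$ is (up to an additive constant) \[ t_1'=\sum_{j=1}^nx_jy_j+\mathrm{Res}_{z=0}\,g(z^{-1})\det(1-zA)^{-1}\frac{dz}{z}=\sum_{j=1}^nx_jy_j+\sum_{m\ge1}g_m\,\mathrm{Sym}(\mathrm{Tr}\,S^mA); \] in particular this element lies in the center of $H_\zeta(\mathfrak{gl}_n)$.
   Context: Fix $n\ge1$; $e_{ij}$ matrix units of $\mathfrak{gl}_n$; $V$ with basis $y_1,\dots,y_n$, $e_{ij}y_k=\delta_{jk}y_i$; $V^*$ dual with dual basis $x_1,\dots,x_n$. Identify $S(\mathfrak{gl}_n)$ with polynomial functions of $A\in\mathfrak{gl}_n$ via the trace form; $\mathrm{Sym}:S(\mathfrak{gl}_n)\to U(\mathfrak{gl}_n)$ is symmetrization, and the expression $\mathrm{Res}_{z=0}g(z^{-1})\det(1-zA)^{-1}dz/z$ is interpreted by expanding $\det(1-zA)^{-1}=\sum_k z^k\,\mathrm{Tr}\,S^kA$ and symmetrizing the coefficients. For $j\ge0$, $r_j(y,x)$ is $\mathrm{Sym}$ of the coefficient of $\tau^j$ in $(x,(1-\tau A)^{-1}y)\det(1-\tau A)^{-1}$. For $\zeta_0,\dots,\zeta_k\in\mathbb{C}$,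 $H_\zeta(\mathfrak{gl}_n)$ is the quotient of $U(\mathfrak{gl}_n)\ltimes T(V\oplus V^* )$ by $[x,x']=[y,y']=0$, $[y,x]=\sum_j\zeta_jr_j(y,x)$; $\zeta(z)=\sum_j\zeta_jz^j$. Let $\mathcal{Q}_i\in S(\mathfrak{gl}_n)$ be defined by $\det(t\,\mathrm{Id}-X)=\sum_{i=0}^n(-1)^it^{n-i}\mathcal{Q}_i(X)$, $\beta_i=\mathrm{Sym}(\mathcal{Q}_i)$, and $t_i=\sum_jx_j[\beta_i,y_j]$ (so $t_1=\sum_jx_jy_j$). By a theorem of Tikaradze, there are elements $c_i$ of the center of $U(\mathfrak{gl}_n)$, unique up to additive constants, such that the center of $H_\zeta(\mathfrak{gl}_n)$ is the polynomial algebra in $t_i'=t_i+c_i$, $1\le i\le n$. The Casimir element of $H_\zeta(\mathfrak{gl}_n)$ is $t_1'$ (defined up to an additive constant). *)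

theory Defs
  imports Complex_Main "HOL-Library.Poly_Mapping" "HOL-Computational_Algebra.Polynomial"
    "HOL-Combinatorics.Permutations"
begin

text \<open>Generators of the free associative algebra: E i j (matrix units of gl_n),
  X i (dual basis x_i of V^*), Y i (basis y_i of V).\<close>
datatype gen = Eg nat nat | Xg nat | Yg nat

datatype word = Word "gen list"

fun word_list :: "word \<Rightarrow> gen list" where "word_list (Word xs) = xs"

instantiation word :: monoid_add
begin
definition zero_word :: word where "zero_word = Word []"
definition plus_word :: "word \<Rightarrow> word \<Rightarrow> word" where
  "plus_word u v = Word (word_list u @ word_list v)"
instance proof
  fix a b c :: word
  show "a + b + c = a + (b + c)" by (cases a; cases b; cases c) (simp add: plus_word_def)
  show "0 + a = a" by (cases a) (simp add: plus_word_def zero_word_def)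
  show "a + 0 = a" by (cases a) (simp add: plus_word_def zero_word_def)
qed
end

text \<open>The free associative complex algebra on the generators (a ring_1).\<close>
type_synonym fa = "word \<Rightarrow>\<^sub>0 complex"

definition sc :: "complex \<Rightarrow> fa" where "sc c = Poly_Mapping.single 0 c"
definition gE :: "nat \<Rightarrow> nat \<Rightarrow> fa" where "gE i j = Poly_Mapping.single (Word [Eg i j]) 1"
definition gX :: "nat \<Rightarrow> fa" where "gX i = Poly_Mapping.single (Word [Xg i]) 1"
definition gY :: "nat \<Rightarrow> fa" where "gY i = Poly_Mapping.single (Word [Yg i]) 1"

definition comm :: "fa \<Rightarrow> fa \<Rightarrow> fa" where "comm a b = a * b - b * a"

definition kd :: "nat \<Rightarrow> nat \<Rightarrow> fa" where "kd i j = (if i = j then 1 else 0)"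

inductive_set tideal :: "fa set \<Rightarrow> fa set" for R where
  base: "r \<in> R \<Longrightarrow> r \<in> tideal R"
| zero: "0 \<in> tideal R"
| add: "a \<in> tideal R \<Longrightarrow> b \<in> tideal R \<Longrightarrow> a + b \<in> tideal R"
| mult: "a \<in> tideal R \<Longrightarrow> u * a * v \<in> tideal R"

text \<open>Under the trace form, the coordinate function A \<mapsto> a_ij on gl_n is the element e_ji.\<close>
definition coordL :: "nat \<Rightarrow> nat \<Rightarrow> fa" where "coordL i j = gE j i"

text \<open>Symmetrization of a product of linear elements u_1 \<cdots> u_m of S(gl_n).\<close>
definition Sym :: "fa list \<Rightarrow> fa" where
  "Sym us = sc (1 / fact (length us)) *
     (\<Sum>p\<in>{p. p permutes {..<length us}}. prod_list (map (\<lambda>k. us ! p k) [0..<length us]))"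

definition idx :: "nat \<Rightarrow> nat \<Rightarrow> nat list set" where
  "idx n l = {js. length js = l \<and> set js \<subseteq> {..<n}}"

text \<open>Index paths a = i_0, i_1, ..., i_k = b, giving (A^k)_ab = sum of products a_{i_0 i_1} ... a_{i_{k-1} i_k}.\<close>
definition paths :: "nat \<Rightarrow> nat \<Rightarrow> nat \<Rightarrow> nat \<Rightarrow> nat list set" where
  "paths n a b k = {is. length is = Suc k \<and> set is \<subseteq> {..<n} \<and> hd is = a \<and> last is = b}"

definition path_factors :: "nat list \<Rightarrow> nat \<Rightarrow> fa list" where
  "path_factors is k = map (\<lambda>t. coordL (is ! t) (is ! Suc t)) [0..<k]"

text \<open>Tr S^l A = (1/l!) sum over sigma in S_l and indices j of prod_t a_{j_t, j_{sigma t}}.\<close>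
definition trS_factors :: "nat list \<Rightarrow> (nat \<Rightarrow> nat) \<Rightarrow> nat \<Rightarrow> fa list" where
  "trS_factors js \<sigma> l = map (\<lambda>t. coordL (js ! t) (js ! \<sigma> t)) [0..<l]"

definition SymTrS :: "nat \<Rightarrow> nat \<Rightarrow> fa" where
  "SymTrS n m = (\<Sum>\<sigma>\<in>{\<sigma>. \<sigma> permutes {..<m}}. \<Sum>js\<in>idx n m.
      sc (1 / fact m) * Sym (trS_factors js \<sigma> m))"

text \<open>Sym((x_a, A^k y_b) Tr S^l A).\<close>
definition SymPT :: "nat \<Rightarrow> nat \<Rightarrow> nat \<Rightarrow> nat \<Rightarrow> nat \<Rightarrow> fa" where
  "SymPT n k l a b = (\<Sum>is\<in>paths n a b k. \<Sum>\<sigma>\<in>{\<sigma>. \<sigma> permutes {..<l}}. \<Sum>js\<in>idx n l.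
      sc (1 / fact l) * Sym (path_factors is k @ trS_factors js \<sigma> l))"

text \<open>r_j(y_b, x_a): Sym of the tau^j coefficient of (x_a,(1-tau A)^{-1} y_b) det(1-tau A)^{-1}.\<close>
definition r_el :: "nat \<Rightarrow> nat \<Rightarrow> nat \<Rightarrow> nat \<Rightarrow> fa" where
  "r_el n j b a = (\<Sum>k\<le>j. SymPT n k (j - k) a b)"

definition relsU :: "nat \<Rightarrow> fa set" where
  "relsU n =
     {comm (gE i j) (gE k l) - (kd j k * gE i l - kd l i * gE k j) | i j k l.
        i < n \<and> j < n \<and> k < n \<and> l < n}
   \<union> {gE i j | i j. \<not> (i < n \<and> j < n)}"

text \<open>Defining relations of H_zeta(gl_n) = (U(gl_n) \<ltimes> T(V \<oplus> V^*)) / relations.\<close>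
definition relsH :: "nat \<Rightarrow> complex poly \<Rightarrow> fa set" where
  "relsH n \<zeta> = relsU n
   \<union> {gX i | i. n \<le> i} \<union> {gY i | i. n \<le> i}
   \<union> {comm (gE i j) (gY k) - kd j k * gY i | i j k. i < n \<and> j < n \<and> k < n}
   \<union> {comm (gE i j) (gX k) + kd i k * gX j | i j k. i < n \<and> j < n \<and> k < n}
   \<union> {comm (gX a) (gX b) | a b. a < n \<and> b < n}
   \<union> {comm (gY a) (gY b) | a b. a < n \<and> b < n}
   \<union> {comm (gY b) (gX a) - (\<Sum>j\<le>degree \<zeta>. sc (coeff \<zeta> j) * r_el n j b a) | a b. a < n \<and> b < n}"

definition gcoef :: "nat \<Rightarrow> complex poly \<Rightarrow> nat \<Rightarrow> complex" where
  "gcoef n f m = coeff f m / pochhammer (of_nat (m + 1)) (n - 1)"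

text \<open>The residue term Res_{z=0} g(z^{-1}) det(1-zA)^{-1} dz/z (without its m = 0 constant).\<close>
definition res_part :: "nat \<Rightarrow> complex poly \<Rightarrow> fa" where
  "res_part n f = (\<Sum>m\<in>{1..degree f}. sc (gcoef n f m) * SymTrS n m)"

definition casimir :: "nat \<Rightarrow> complex poly \<Rightarrow> fa" where
  "casimir n f = (\<Sum>j<n. gX j * gY j) + res_part n f"

end

theory Submission
  imports Defs "HOL-Combinatorics.Multiset_Permutations"
begin

text \<open>The algebra \<open>S(gl\<^sub>n)\<close> is a polynomial ring, on which the matrix \<open>D\<close> with entries
  \<open>D\<^sub>a\<^sub>b = \<partial>/\<partial>e\<^sub>a\<^sub>b\<close> acts. Since \<open>y e\<^sup>L = e\<^sup>L (e\<^sup>-\<^sup>L y)\<close> for \<open>L\<close> in \<open>gl\<^sub>n\<close>, symmetrization satisfies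
  \<open>y\<^sub>b Sym F = \<Sum>\<^sub>a Sym ((e\<^sup>-\<^sup>D)\<^sub>a\<^sub>b F) y\<^sub>a\<close>, and symmetrically \<open>(Sym F) x\<^sub>b = \<Sum>\<^sub>a x\<^sub>a Sym ((e\<^sup>-\<^sup>D)\<^sub>b\<^sub>a F)\<close>.
  Let \<open>h\<^sub>m = Tr S\<^sup>m A\<close> and \<open>P\<^sub>j = \<Sum>\<^sub>k A\<^sup>k h\<^sub>j\<^sub>-\<^sub>k\<close>, so that the entries of \<open>Sym P\<^sub>j\<close> are the \<open>r\<^sub>j\<close>. Newton's
  identities give \<open>D h\<^sub>m = P\<^sub>m\<^sub>-\<^sub>1\<close> and \<open>D P\<^sub>j = (j + n) P\<^sub>j\<^sub>-\<^sub>1\<close>. Hence the commutators of \<open>\<Sum> g\<^sub>m Sym h\<^sub>m\<close> with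
  \<open>x\<^sub>b\<close> and \<open>y\<^sub>b\<close> are combinations of the \<open>r\<^sub>j\<close>, and the difference equation for \<open>f\<close> says exactly
  that they cancel those of \<open>\<Sum> x\<^sub>j y\<^sub>j\<close>. Invariance under \<open>gl\<^sub>n\<close> amounts to \<open>P\<^sub>j A = A P\<^sub>j\<close>.\<close>

subsection \<open>Newton's identity for sums over permutations\<close>

definition mmul :: "nat \<Rightarrow> (nat \<Rightarrow> nat \<Rightarrow> 'a::comm_ring_1) \<Rightarrow> (nat \<Rightarrow> nat \<Rightarrow> 'a) \<Rightarrow> nat \<Rightarrow> nat \<Rightarrow> 'a" where
  "mmul n X Y a b = (\<Sum>c<n. X a c * Y c b)"

primrec mpow :: "nat \<Rightarrow> (nat \<Rightarrow> nat \<Rightarrow> 'a::comm_ring_1) \<Rightarrow> nat \<Rightarrow> nat \<Rightarrow> nat \<Rightarrow> 'a" where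
  "mpow n X 0 = (\<lambda>a b. if a = b then 1 else 0)"
| "mpow n X (Suc k) = mmul n X (mpow n X k)"

definition tr :: "nat \<Rightarrow> (nat \<Rightarrow> nat \<Rightarrow> 'a::comm_ring_1) \<Rightarrow> 'a" where
  "tr n X = (\<Sum>c<n. X c c)"

lemma mmul_assoc: "mmul n (mmul n X Y) Z a b = mmul n X (mmul n Y Z) a b"
proof -
  have "mmul n (mmul n X Y) Z a b = (\<Sum>c<n. \<Sum>d<n. X a d * (Y d c * Z c b))"
    by (simp add: mmul_def sum_distrib_right mult.assoc)
  also have "\<dots> = (\<Sum>d<n. \<Sum>c<n. X a d * (Y d c * Z c b))"
    by (rule sum.swap)
  finally show ?thesis by (simp add: mmul_def sum_distrib_left)
qed

lemma mmul_cong: "\<lbrakk>\<And>c. c < n \<Longrightarrow> X a c = X' a c; \<And>c. c < n \<Longrightarrow> Y c b = Y' c b\<rbrakk> \<Longrightarrow> mmul n X Y a b = mmul n X' Y' a b"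
  by (simp add: mmul_def)

lemma mmul_one_left: "a < n \<Longrightarrow> mmul n (mpow n Z 0) Y a b = Y a b"
  by (simp add: mmul_def if_distrib[of "\<lambda>x. x * _"] cong: if_cong)

lemma mmul_one_right: "b < n \<Longrightarrow> mmul n Y (mpow n Z 0) a b = Y a b"
  by (simp add: mmul_def if_distrib[of "\<lambda>x. _ * x"] cong: if_cong)

lemma mmul_mpow: "a < n \<Longrightarrow> mmul n (mpow n X k) (mpow n X l) a b = mpow n X (k + l) a b"
proof (induction k arbitrary: a)
  case 0
  then show ?case by (simp only: mmul_one_left add_0)
next
  case (Suc k)
  have "mmul n (mpow n X (Suc k)) (mpow n X l) a b = mmul n X (mmul n (mpow n X k) (mpow n X l)) a b"
    by (simp add: mmul_assoc)
  also have "\<dots> = mmul n X (mpow n X (k + l)) a b"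
    by (rule mmul_cong) (simp_all add: Suc.IH)
  finally show ?case by simp
qed

lemma sum_mpow_mult: "a < n \<Longrightarrow> (\<Sum>c<n. mpow n X k a c * mpow n X l c b) = mpow n X (k + l) a b"
  using mmul_mpow[of a n X k l b] by (simp add: mmul_def)

lemma mpow_one: "b < n \<Longrightarrow> mpow n X (Suc 0) a b = X a b"
  by (metis mmul_one_right mpow.simps(2))

lemma mpow_Suc_right: "\<lbrakk>a < n; b < n\<rbrakk> \<Longrightarrow> mpow n X (Suc k) a b = (\<Sum>c<n. mpow n X k a c * X c b)"
  using sum_mpow_mult[of a n X k "Suc 0" b] by (simp add: mpow_one del: mpow.simps)

lemma sum_PiE_insert:
  assumes "i \<notin> T"
  shows "(\<Sum>j\<in>PiE (insert i T) B. f j) = (\<Sum>j\<in>PiE T B. \<Sum>c\<in>B i. f (j(i := c)))"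
proof -
  have "(\<Sum>j\<in>PiE (insert i T) B. f j) = (\<Sum>(c, j)\<in>B i \<times> PiE T B. f (j(i := c)))"
    using sum.reindex[OF inj_combinator[OF assms], of f B] by (simp add: PiE_insert_eq case_prod_unfold)
  also have "\<dots> = (\<Sum>c\<in>B i. \<Sum>j\<in>PiE T B. f (j(i := c)))"
    by (simp add: sum.cartesian_product)
  finally show ?thesis by (subst sum.swap)
qed

text \<open>\<open>cycle_sum n A S\<close> is the sum over the permutations of \<open>S\<close> of the products of the traces
  \<open>tr (A ^ length)\<close> over their cycles; in \<open>marked_cycle_sum\<close> the factor leaving the marked
  point \<open>i\<close> is an entry of \<open>X\<close> instead of \<open>A\<close>.\<close>

definition cycle_sum :: "nat \<Rightarrow> (nat \<Rightarrow> nat \<Rightarrow> 'a::comm_ring_1) \<Rightarrow> nat set \<Rightarrow> 'a" where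
  "cycle_sum n A S = (\<Sum>\<sigma> | \<sigma> permutes S. \<Sum>j\<in>S \<rightarrow>\<^sub>E {..<n}. \<Prod>t\<in>S. A (j t) (j (\<sigma> t)))"

definition marked_cycle_sum ::
    "nat \<Rightarrow> (nat \<Rightarrow> nat \<Rightarrow> 'a::comm_ring_1) \<Rightarrow> (nat \<Rightarrow> nat \<Rightarrow> 'a) \<Rightarrow> nat \<Rightarrow> nat set \<Rightarrow> 'a" where
  "marked_cycle_sum n A X i S =
    (\<Sum>\<sigma> | \<sigma> permutes S. \<Sum>j\<in>S \<rightarrow>\<^sub>E {..<n}. X (j i) (j (\<sigma> i)) * (\<Prod>t\<in>S - {i}. A (j t) (j (\<sigma> t))))"

text \<open>The mark starts as the first power of \<open>A\<close>, so that the recursion below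
  stays within the marks \<open>mpow n A r\<close>.\<close>

lemma cycle_sum_eq_marked:
  assumes "finite S" "i \<in> S"
  shows "cycle_sum n A S = marked_cycle_sum n A (mpow n A (Suc 0)) i S"
  unfolding cycle_sum_def marked_cycle_sum_def
proof (intro sum.cong refl)
  fix \<sigma> j assume "\<sigma> \<in> {\<sigma>. \<sigma> permutes S}" "j \<in> S \<rightarrow>\<^sub>E {..<n}"
  then have "j (\<sigma> i) < n" using assms(2) by (auto simp: permutes_in_image)
  then show "(\<Prod>t\<in>S. A (j t) (j (\<sigma> t))) = mpow n A (Suc 0) (j i) (j (\<sigma> i)) * (\<Prod>t\<in>S - {i}. A (j t) (j (\<sigma> t)))"
    using assms by (subst mpow_one) (auto simp: prod.remove)
qed

text \<open>A permutation of \<open>insert i T\<close> either fixes \<open>i\<close>, and the loop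
  there contributes the trace of \<open>X\<close>, or it arises from a permutation of
  \<open>T\<close> by inserting \<open>i\<close> right after some \<open>k\<close>. In the second
  case summing over the index at \<open>i\<close> multiplies the factor \<open>A\<close> leaving
  \<open>k\<close> by \<open>X\<close>, and the mark moves to \<open>k\<close>.\<close>

lemma marked_cycle_sum_insert:
  assumes fin: "finite T" and i: "i \<notin> T"
  shows "marked_cycle_sum n A X i (insert i T) =
    tr n X * cycle_sum n A T + (\<Sum>k\<in>T. marked_cycle_sum n A (mmul n A X) k T)"
proof -
  let ?P = "{\<sigma>. \<sigma> permutes T}" and ?J = "T \<rightarrow>\<^sub>E {..<n}"
  define G where "G \<sigma> j = X (j i) (j (\<sigma> i)) * (\<Prod>t\<in>T. A (j t) (j (\<sigma> t)))" for \<sigma> j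
  define K where "K \<sigma> = (\<Sum>j\<in>?J. \<Sum>c<n. G \<sigma> (j(i := c)))" for \<sigma>
  have "marked_cycle_sum n A X i (insert i T) = (\<Sum>\<sigma> | \<sigma> permutes insert i T. K \<sigma>)"
    using i by (simp add: marked_cycle_sum_def G_def K_def sum_PiE_insert)
  also have "\<dots> = (\<Sum>b\<in>insert i T. \<Sum>q\<in>?P. K (Transposition.transpose i b \<circ> q))"
    by (rule sum_over_permutations_insert[OF fin i])
  also have "\<dots> = (\<Sum>q\<in>?P. K q) + (\<Sum>b\<in>T. \<Sum>q\<in>?P. K (Transposition.transpose i b \<circ> q))"
    using fin i by simp
  also have "(\<Sum>q\<in>?P. K q) = tr n X * cycle_sum n A T"
  proof -
    have "K q = (\<Sum>c<n. X c c) * (\<Sum>j\<in>?J. \<Prod>t\<in>T. A (j t) (j (q t)))" if "q permutes T" for q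
    proof -
      have "G q (j(i := c)) = X c c * (\<Prod>t\<in>T. A (j t) (j (q t)))" for j c
      proof -
        have "q i = i" using that i by (simp add: permutes_not_in)
        moreover have "t \<noteq> i \<and> q t \<noteq> i" if "t \<in> T" for t
          using \<open>q permutes T\<close> i that by (metis permutes_in_image)
        ultimately show ?thesis unfolding G_def by (auto intro!: prod.cong arg_cong2[of _ _ _ _ "(*)"])
      qed
      then show ?thesis by (simp add: K_def sum_distrib_right sum_distrib_left)
    qed
    then show ?thesis by (simp add: cycle_sum_def tr_def sum_distrib_left)
  qed
  also have "(\<Sum>b\<in>T. \<Sum>q\<in>?P. K (Transposition.transpose i b \<circ> q)) = (\<Sum>k\<in>T. marked_cycle_sum n A (mmul n A X) k T)"
  proof -
    have K: "K (Transposition.transpose i (q k) \<circ> q) =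
        (\<Sum>j\<in>?J. mmul n A X (j k) (j (q k)) * (\<Prod>t\<in>T - {k}. A (j t) (j (q t))))"
      if q: "q permutes T" and k: "k \<in> T" for q k
    proof -
      have "G (Transposition.transpose i (q k) \<circ> q) (j(i := c)) =
          A (j k) c * X c (j (q k)) * (\<Prod>t\<in>T - {k}. A (j t) (j (q t)))" for j c
      proof -
        have qi: "q i = i" using q i by (simp add: permutes_not_in)
        have qT: "t \<noteq> i \<and> q t \<noteq> i" if "t \<in> T" for t
          using q i that by (metis permutes_in_image)
        have inj: "q t \<noteq> q k" if "t \<noteq> k" for t
          using q that by (metis permutes_inverses(2))
        have "(\<Prod>t\<in>T - {k}. A ((j(i := c)) t) ((j(i := c)) ((Transposition.transpose i (q k) \<circ> q) t)))
            = (\<Prod>t\<in>T - {k}. A (j t) (j (q t)))"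
          using qT inj by (intro prod.cong) (auto simp: transpose_def)
        then show ?thesis
          unfolding G_def using fin k qi qT[OF k] by (simp add: prod.remove[of T k] algebra_simps)
      qed
      then show ?thesis by (simp add: K_def mmul_def sum_distrib_right)
    qed
    have "(\<Sum>b\<in>T. \<Sum>q\<in>?P. K (Transposition.transpose i b \<circ> q)) = (\<Sum>q\<in>?P. \<Sum>b\<in>T. K (Transposition.transpose i b \<circ> q))"
      by (rule sum.swap)
    \<comment> \<open>Writing \<open>b\<close> as \<open>q k\<close> makes the predecessor
      \<open>k\<close> of the inserted point the summation variable.\<close>
    also have "\<dots> = (\<Sum>q\<in>?P. \<Sum>k\<in>T. K (Transposition.transpose i (q k) \<circ> q))"
    proof (rule sum.cong[OF refl])
      fix q assume "q \<in> ?P"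
      then have "bij_betw q T T" by (simp add: permutes_imp_bij)
      then show "(\<Sum>b\<in>T. K (Transposition.transpose i b \<circ> q)) = (\<Sum>k\<in>T. K (Transposition.transpose i (q k) \<circ> q))"
        by (rule sum.reindex_bij_betw[symmetric])
    qed
    also have "\<dots> = (\<Sum>k\<in>T. \<Sum>q\<in>?P. K (Transposition.transpose i (q k) \<circ> q))"
      by (rule sum.swap)
    finally show ?thesis by (simp add: K marked_cycle_sum_def)
  qed
  finally show ?thesis .
qed

text \<open>Unrolling the insertion recursion takes the points of the cycle through the mark away
  one by one. The trace powers collected on the way form the right-hand side of Newton's
  identity.\<close>

lemma cycle_sum_newton:
  fixes A :: "nat \<Rightarrow> nat \<Rightarrow> 'a::{comm_ring_1, ring_char_0}"
  assumes h0: "h 0 = 1"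
    and h: "\<And>m. of_nat (Suc m) * h (Suc m) = (\<Sum>s\<le>m. tr n (mpow n A (Suc s)) * h (m - s))"
  shows "finite S \<Longrightarrow> cycle_sum n A S = fact (card S) * h (card S)"
proof -
  \<comment> \<open>Each insertion multiplies the mark by \<open>A\<close>, so the claim is made for
    every power \<open>r\<close>; the outer induction takes \<open>r = Suc 0\<close>. The third
    assumption is what that induction supplies for smaller sets.\<close>
  have step: "marked_cycle_sum n A (mpow n A r) i (insert i T) =
      fact (card T) * (\<Sum>s\<le>card T. tr n (mpow n A (r + s)) * h (card T - s))"
    if "finite T" "i \<notin> T" "\<And>U. finite U \<Longrightarrow> card U \<le> card T \<Longrightarrow> cycle_sum n A U = fact (card U) * h (card U)"
    for T i r
    using that
  proof (induction "card T" arbitrary: T i r)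
    case 0
    then show ?case by (subst marked_cycle_sum_insert) (auto simp: h0)
  next
    case (Suc m)
    have rec: "marked_cycle_sum n A (mpow n A (Suc r)) k T = fact m * (\<Sum>s\<le>m. tr n (mpow n A (Suc r + s)) * h (m - s))"
      if "k \<in> T" for k
    proof -
      have "card (T - {k}) = m" using Suc that by simp
      moreover have "insert k (T - {k}) = T" using that by auto
      ultimately show ?thesis using Suc.hyps(1)[of "T - {k}" k "Suc r"] Suc.prems Suc.hyps(2) by auto
    qed
    have "marked_cycle_sum n A (mpow n A r) i (insert i T) =
        tr n (mpow n A r) * cycle_sum n A T + (\<Sum>k\<in>T. marked_cycle_sum n A (mpow n A (Suc r)) k T)"
      using Suc.prems by (subst marked_cycle_sum_insert) auto
    also have "\<dots> = fact (Suc m) * (tr n (mpow n A r) * h (Suc m))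
        + of_nat (Suc m) * (fact m * (\<Sum>s\<le>m. tr n (mpow n A (Suc r + s)) * h (m - s)))"
      using Suc rec by (simp add: algebra_simps del: mpow.simps)
    also have "\<dots> = fact (Suc m) * (\<Sum>s\<le>Suc m. tr n (mpow n A (r + s)) * h (Suc m - s))"
      by (subst sum.atMost_Suc_shift) (simp add: algebra_simps del: mpow.simps)
    finally show ?case using Suc.hyps(2) by simp
  qed
  show "finite S \<Longrightarrow> cycle_sum n A S = fact (card S) * h (card S)"
  proof (induction "card S" arbitrary: S rule: less_induct)
    case less
    show ?case
    proof (cases "S = {}")
      case True
      then show ?thesis by (simp add: cycle_sum_def h0)
    next
      case False
      then obtain i T where S: "S = insert i T" "i \<notin> T" by (meson ex_in_conv mk_disjoint_insert)
      with less have T: "finite T" "card S = Suc (card T)" by auto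
      have "cycle_sum n A S = marked_cycle_sum n A (mpow n A (Suc 0)) i (insert i T)"
        using cycle_sum_eq_marked[of S i n A] less.prems S by blast
      also have "\<dots> = fact (card T) * (\<Sum>s\<le>card T. tr n (mpow n A (Suc 0 + s)) * h (card T - s))"
        by (rule step) (use less S T in auto)
      also have "\<dots> = fact (card S) * h (card S)"
        unfolding T(2) fact_Suc mult.assoc by (subst mult.left_commute) (simp only: h add_0 add_Suc)
      finally show ?thesis .
    qed
  qed
qed

subsection \<open>The polynomial ring S(gl_n)\<close>

text \<open>Monomials are multisets of index pairs, so that adding multisets multiplies monomials.
  The size \<open>n\<close> enters only through ranges of summation.\<close>

type_synonym sg = "(nat \<times> nat) multiset \<Rightarrow>\<^sub>0 complex"

definition cst :: "complex \<Rightarrow> sg" where "cst c = Poly_Mapping.single 0 c"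
definition var :: "nat \<Rightarrow> nat \<Rightarrow> sg" where "var p q = Poly_Mapping.single {#(p, q)#} 1"

text \<open>The indices are transposed because the trace form identifies the coordinate a_ab with
  e_ba; this is the commutative counterpart of \<open>coordL\<close>.\<close>

definition crd :: "nat \<Rightarrow> nat \<Rightarrow> sg" where "crd a b = var b a"

lift_definition pd :: "nat \<Rightarrow> nat \<Rightarrow> sg \<Rightarrow> sg" is
  "\<lambda>p q F M. of_nat (Suc (count M (p, q))) * F (add_mset (p, q) M)"
proof -
  fix p q and F :: "(nat \<times> nat) multiset \<Rightarrow> complex"
  assume "finite {M. F M \<noteq> 0}"
  then have "finite (add_mset (p, q) -` {M. F M \<noteq> 0})"
    by (rule finite_vimageI) (simp add: inj_on_def)
  then show "finite {M. of_nat (Suc (count M (p, q))) * F (add_mset (p, q) M) \<noteq> 0}"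
    by (rule rev_finite_subset) auto
qed

lemma poly_mapping_single_induct [case_names single add]:
  fixes F :: "'a \<Rightarrow>\<^sub>0 'b::comm_monoid_add"
  assumes single: "\<And>k c. P (Poly_Mapping.single k c)"
    and add: "\<And>F G. P F \<Longrightarrow> P G \<Longrightarrow> P (F + G)"
  shows "P F"
proof -
  have "P (\<Sum>k\<in>K. Poly_Mapping.single k (Poly_Mapping.lookup F k))" if "finite K" for K
    using that
  proof (induction K)
    case empty
    show ?case using single[of _ 0] by simp
  qed (simp add: single add)
  moreover have "(\<Sum>k\<in>Poly_Mapping.keys F. Poly_Mapping.single k (Poly_Mapping.lookup F k)) = F"
    by (rule poly_mapping_eqI) (simp add: lookup_sum lookup_single when_def in_keys_iff)
  ultimately show ?thesis by (metis finite_keys)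
qed

lemma lookup_pd: "Poly_Mapping.lookup (pd p q F) M = of_nat (Suc (count M (p, q))) * Poly_Mapping.lookup F (add_mset (p, q) M)"
  by transfer simp

lemma pd_zero [simp]: "pd p q 0 = 0"
  by (rule poly_mapping_eqI) (simp add: lookup_pd)

lemma pd_add: "pd p q (F + G) = pd p q F + pd p q G"
  by (rule poly_mapping_eqI) (simp add: lookup_pd lookup_add algebra_simps)

lemma pd_sum: "pd p q (\<Sum>i\<in>I. f i) = (\<Sum>i\<in>I. pd p q (f i))"
  by (induction I rule: infinite_finite_induct) (simp_all add: pd_add)

lemma pd_uminus: "pd p q (- F) = - pd p q F"
  by (rule poly_mapping_eqI) (simp add: lookup_pd)

lemma pd_diff: "pd p q (F - G) = pd p q F - pd p q G"
  using pd_add[of p q F "- G"] by (simp add: pd_uminus)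

lemma pd_single:
  "pd p q (Poly_Mapping.single M c) = Poly_Mapping.single (M - {#(p, q)#}) (of_nat (count M (p, q)) * c)"
proof (cases "(p, q) \<in># M")
  case True
  then obtain K where "M = add_mset (p, q) K" by (meson multi_member_split)
  then show ?thesis by (intro poly_mapping_eqI) (auto simp: lookup_pd lookup_single when_def)
next
  case False
  then show ?thesis
    by (intro poly_mapping_eqI) (auto simp: lookup_pd lookup_single when_def not_in_iff)
qed

lemma pd_mult: "pd p q (F * G) = pd p q F * G + F * pd p q G"
proof (induction F rule: poly_mapping_single_induct)
  case (single M c)
  show ?case
  proof (induction G rule: poly_mapping_single_induct)
    case (single N d)
    \<comment> \<open>Multiset subtraction truncates, so the two monomials may differ when
      \<open>(p, q)\<close> is not in \<open>M\<close>; the coefficient is then zero.\<close>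
    have "Poly_Mapping.single (M + N - {#(p, q)#}) (of_nat (count M (p, q)) * c * d) =
        Poly_Mapping.single (M - {#(p, q)#} + N) (of_nat (count M (p, q)) * c * d)"
      by (cases "(p, q) \<in># M") (auto simp: not_in_iff dest!: multi_member_split)
    moreover have "Poly_Mapping.single (M + N - {#(p, q)#}) (c * (of_nat (count N (p, q)) * d)) =
        Poly_Mapping.single (M + (N - {#(p, q)#})) (c * (of_nat (count N (p, q)) * d))"
      by (cases "(p, q) \<in># N") (auto simp: not_in_iff dest!: multi_member_split)
    ultimately show ?case
      by (simp add: mult_single pd_single single_add[symmetric] algebra_simps)
        (simp add: single_add algebra_simps)
  qed (simp add: pd_add algebra_simps)
qed (simp add: pd_add algebra_simps)

lemma pd_commute: "pd p q (pd r s F) = pd r s (pd p q F)"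
  by (rule poly_mapping_eqI) (auto simp: lookup_pd add_mset_commute)

lemma pd_cst [simp]: "pd p q (cst c) = 0"
  by (simp add: cst_def pd_single)

lemma pd_cst_mult: "pd p q (cst c * F) = cst c * pd p q F"
  by (simp add: pd_mult)

lemma cst_of_nat: "cst (of_nat k) = of_nat k"
  by (simp add: cst_def)

lemma cst_1 [simp]: "cst 1 = 1" and cst_0 [simp]: "cst 0 = 0"
  by (simp_all add: cst_def)

lemma cst_mult: "cst (a * b) = cst a * cst b"
  by (simp add: cst_def mult_single)

lemma cst_add: "cst (a + b) = cst a + cst b"
  by (simp add: cst_def single_add)

lemma pd_one [simp]: "pd p q 1 = 0"
  using pd_cst[of p q 1] by simp

lemma pd_of_nat_mult: "pd p q (of_nat k * F) = of_nat k * pd p q F"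
  using pd_cst_mult[of p q "of_nat k"] by (simp add: cst_of_nat)

lemma pd_var: "pd p q (var r s) = (if p = r \<and> q = s then 1 else 0)"
  by (auto simp: var_def pd_single)

lemma pd_crd: "pd p q (crd a b) = (if p = b \<and> q = a then 1 else 0)"
  by (simp add: crd_def pd_var)

lemma pd_prod:
  assumes "finite S"
  shows "pd p q (\<Prod>i\<in>S. f i) = (\<Sum>i\<in>S. pd p q (f i) * (\<Prod>j\<in>S - {i}. f j))"
  using assms
proof (induction S)
  case (insert x S)
  have "(\<Prod>j\<in>insert x S - {i}. f j) = f x * (\<Prod>j\<in>S - {i}. f j)" if "i \<in> S" for i
    using insert that by (subst insert_Diff_if) auto
  with insert show ?case
    by (simp add: pd_mult sum_distrib_left algebra_simps)
qed simp

lemma of_nat_mult_cancel: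
  fixes F :: sg
  assumes "of_nat (Suc m) * F = of_nat (Suc m) * G"
  shows "F = G"
proof -
  have *: "cst (1 / of_nat (Suc m)) * of_nat (Suc m) = 1"
    by (simp del: of_nat_Suc add: cst_of_nat[symmetric] cst_mult[symmetric])
  show ?thesis
    using arg_cong[OF assms, of "(*) (cst (1 / of_nat (Suc m)))"]
    by (simp only: mult.assoc[symmetric] * mult_1_left)
qed

subsection \<open>Complete symmetric functions and their derivatives\<close>

text \<open>\<open>hs n m\<close> is the trace of the \<open>m\<close>-th symmetric power of the generic matrix, defined by
  Newton's identity \<open>m h\<^sub>m = p\<^sub>1 h\<^sub>m\<^sub>-\<^sub>1 + \<dots> + p\<^sub>m h\<^sub>0\<close>.\<close>

fun hs :: "nat \<Rightarrow> nat \<Rightarrow> sg" where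
  "hs n 0 = 1"
| "hs n (Suc m) = cst (1 / of_nat (Suc m)) * (\<Sum>s\<le>m. tr n (mpow n crd (Suc s)) * hs n (m - s))"

declare hs.simps(2) [simp del] mpow.simps(2) [simp del]

lemma hs_Suc: "of_nat (Suc m) * hs n (Suc m) = (\<Sum>s\<le>m. tr n (mpow n crd (Suc s)) * hs n (m - s))"
proof -
  have "of_nat (Suc m) * cst (1 / of_nat (Suc m)) = 1"
    by (simp del: of_nat_Suc add: cst_of_nat[symmetric] cst_mult[symmetric])
  then show ?thesis by (simp only: hs.simps mult.assoc[symmetric] mult_1)
qed

lemma newton: "(\<Sum>s<m. tr n (mpow n crd (Suc s)) * hs n (m - 1 - s)) = of_nat m * hs n m"
  using hs_Suc[of "m - 1" n] by (cases m) (simp_all add: lessThan_Suc_atMost)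

lemma tr_mpow_0: "tr n (mpow n X 0) = of_nat n"
  by (simp add: tr_def)

text \<open>The extra term \<open>s = 0\<close> is the trace of the identity matrix, which is how
  \<open>n\<close> enters the factor in \<open>pd_pm\<close>.\<close>

lemma newton0: "(\<Sum>s\<le>m. tr n (mpow n crd s) * hs n (m - s)) = of_nat (n + m) * hs n m"
proof (cases m)
  case 0
  then show ?thesis by (simp add: tr_mpow_0 del: mpow.simps)
next
  case (Suc k)
  have "(\<Sum>s\<le>m. tr n (mpow n crd s) * hs n (m - s)) =
      of_nat n * hs n m + (\<Sum>s\<le>k. tr n (mpow n crd (Suc s)) * hs n (k - s))"
    unfolding Suc by (subst sum.atMost_Suc_shift) (simp add: tr_mpow_0 del: mpow.simps)
  then show ?thesis
    by (simp only: hs_Suc[symmetric] Suc of_nat_add distrib_right)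
qed

text \<open>The derivative by e_pq is the one by the coordinate a_qp. By the Leibniz rule, removing
  one such factor cuts a path from \<open>a\<close> to \<open>b\<close> into a path from
  \<open>a\<close> to \<open>q\<close> and one from \<open>p\<close> to \<open>b\<close>.\<close>

lemma pd_mpow:
  assumes "p < n" "q < n" "a < n"
  shows "pd p q (mpow n crd k a b) = (\<Sum>s<k. mpow n crd s a q * mpow n crd (k - 1 - s) p b)"
  using assms(3)
proof (induction k arbitrary: a)
  case 0
  then show ?case by simp
next
  case (Suc k)
  have "pd p q (mpow n crd (Suc k) a b) =
      (\<Sum>c<n. (if p = c \<and> q = a then 1 else 0) * mpow n crd k c b) +
      (\<Sum>c<n. crd a c * pd p q (mpow n crd k c b))"
    by (simp add: mpow.simps mmul_def pd_sum pd_mult pd_crd sum.distrib)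
  also have "(\<Sum>c<n. (if p = c \<and> q = a then 1 else 0) * mpow n crd k c b) =
      mpow n crd 0 a q * mpow n crd k p b"
    using assms by (cases "q = a") (simp_all add: if_distrib[of "\<lambda>x. x * _"] cong: if_cong)
  also have "(\<Sum>c<n. crd a c * pd p q (mpow n crd k c b)) =
      (\<Sum>c<n. \<Sum>s<k. crd a c * mpow n crd s c q * mpow n crd (k - 1 - s) p b)"
    by (simp add: Suc.IH sum_distrib_left mult.assoc)
  also have "\<dots> = (\<Sum>s<k. mpow n crd (Suc s) a q * mpow n crd (k - Suc s) p b)"
    by (subst sum.swap) (simp add: mpow.simps mmul_def sum_distrib_right)
  finally show ?case
    by (subst sum.lessThan_Suc_shift) simp
qed

lemma pd_tr_mpow:
  assumes "p < n" "q < n"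
  shows "pd p q (tr n (mpow n crd k)) = of_nat k * mpow n crd (k - 1) p q"
proof -
  have "pd p q (tr n (mpow n crd k)) = (\<Sum>c<n. \<Sum>s<k. mpow n crd (k - 1 - s) p c * mpow n crd s c q)"
    using assms by (simp add: tr_def pd_sum pd_mpow mult.commute)
  also have "\<dots> = (\<Sum>s<k. \<Sum>c<n. mpow n crd (k - 1 - s) p c * mpow n crd s c q)"
    by (rule sum.swap)
  also have "\<dots> = (\<Sum>s<k. mpow n crd (k - 1) p q)"
    using assms by (intro sum.cong) (auto simp: sum_mpow_mult)
  finally show ?thesis by simp
qed

text \<open>\<open>pm n (Suc j) a b\<close> is the coefficient of \<open>\<tau>\<^sup>j\<close> in the matrix entry
  of \<open>(1 - \<tau> A)\<^sup>-\<^sup>1 det (1 - \<tau> A)\<^sup>-\<^sup>1\<close>.\<close>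

definition pm :: "nat \<Rightarrow> nat \<Rightarrow> nat \<Rightarrow> nat \<Rightarrow> sg" where
  "pm n m a b = (\<Sum>k<m. mpow n crd k a b * hs n (m - 1 - k))"

lemma sum_triangle_swap:
  "(\<Sum>s<(m::nat). \<Sum>k<m - s. f s k) = (\<Sum>k<m. \<Sum>s<m - k. f s k)"
  by (simp add: sum.Sigma)
    (rule sum.reindex_bij_witness[of _ prod.swap prod.swap]; auto)

text \<open>Newton's identity is differentiated. The traces contribute the term A^k h_(l-k) with
  weight k + 1; the derivatives of the h, known by induction, contribute it with weight l - k after
  a second use of Newton's identity. The total weight l + 1 is cancelled.\<close>

lemma pd_hs:
  assumes "a < n" "b < n"
  shows "pd a b (hs n m) = pm n m a b"
proof (induction m rule: less_induct)
  case (less m)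
  show ?case
  proof (cases m)
    case 0
    then show ?thesis by (simp add: pm_def)
  next
    case (Suc l)
    have "of_nat (Suc l) * pd a b (hs n m) =
        (\<Sum>s\<le>l. of_nat (Suc s) * mpow n crd s a b * hs n (l - s))
        + (\<Sum>s\<le>l. tr n (mpow n crd (Suc s)) * pd a b (hs n (l - s)))"
      unfolding Suc pd_of_nat_mult[symmetric] hs_Suc pd_sum pd_mult
      using assms by (simp add: pd_tr_mpow sum.distrib del: of_nat_Suc)
    also have "(\<Sum>s\<le>l. tr n (mpow n crd (Suc s)) * pd a b (hs n (l - s))) =
        (\<Sum>s<l. \<Sum>k<l - s. mpow n crd k a b * (tr n (mpow n crd (Suc s)) * hs n (l - k - 1 - s)))"
      using Suc by (simp add: lessThan_Suc_atMost[symmetric] less.IH pm_def sum_distrib_left)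
        (intro sum.cong refl, simp add: algebra_simps diff_commute)
    also have "\<dots> = (\<Sum>k<l. mpow n crd k a b * (of_nat (l - k) * hs n (l - k)))"
      by (subst sum_triangle_swap) (simp only: newton sum_distrib_left[symmetric])
    also have "\<dots> = (\<Sum>k\<le>l. of_nat (l - k) * mpow n crd k a b * hs n (l - k))"
      by (simp add: lessThan_Suc_atMost[symmetric] algebra_simps)
    also have "(\<Sum>s\<le>l. of_nat (Suc s) * mpow n crd s a b * hs n (l - s)) + \<dots> =
        (\<Sum>k\<le>l. of_nat (Suc l) * (mpow n crd k a b * hs n (l - k)))"
      unfolding sum.distrib[symmetric]
    proof (rule sum.cong[OF refl])
      fix k assume "k \<in> {..l}"
      then have "of_nat (Suc l) = (of_nat (Suc k) + of_nat (l - k) :: sg)"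
        unfolding of_nat_add[symmetric] by simp
      then show "of_nat (Suc k) * mpow n crd k a b * hs n (l - k) + of_nat (l - k) * mpow n crd k a b * hs n (l - k)
          = of_nat (Suc l) * (mpow n crd k a b * hs n (l - k))"
        by (simp only: distrib_right mult.assoc)
    qed
    finally have "of_nat (Suc l) * pd a b (hs n m) = of_nat (Suc l) * pm n m a b"
      using Suc by (simp only: pm_def sum_distrib_left lessThan_Suc_atMost diff_Suc_1)
    then show ?thesis by (rule of_nat_mult_cancel)
  qed
qed

text \<open>The coefficient of A^e h_(m-1-e) is counted. Differentiating the powers of A gives n +
  (m - 1 - e) by \<open>newton0\<close>, since one of the two pieces closes up to a trace.
  Differentiating the h gives e + 1, one for each splitting of the exponent e.\<close>

lemma pd_pm:
  assumes "a < n" "b < n"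
  shows "(\<Sum>c<n. pd a c (pm n (Suc m) c b)) = of_nat (m + n) * pm n m a b"
proof -
  have 1: "(\<Sum>c<n. pd a c (mpow n crd k c b)) = (\<Sum>s<k. tr n (mpow n crd s) * mpow n crd (k - 1 - s) a b)" for k
  proof -
    have "(\<Sum>c<n. pd a c (mpow n crd k c b)) = (\<Sum>c<n. \<Sum>s<k. mpow n crd s c c * mpow n crd (k - 1 - s) a b)"
      using assms by (simp add: pd_mpow)
    then show ?thesis by (subst (asm) sum.swap) (simp add: tr_def sum_distrib_right)
  qed
  have 2: "(\<Sum>c<n. mpow n crd k c b * pm n l a c) = (\<Sum>i<l. mpow n crd (i + k) a b * hs n (l - 1 - i))" for k l
  proof -
    have "(\<Sum>c<n. mpow n crd k c b * pm n l a c) =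
        (\<Sum>c<n. \<Sum>i<l. mpow n crd i a c * mpow n crd k c b * hs n (l - 1 - i))"
      by (simp add: pm_def sum_distrib_left algebra_simps)
    also have "\<dots> = (\<Sum>i<l. \<Sum>c<n. mpow n crd i a c * mpow n crd k c b * hs n (l - 1 - i))"
      by (rule sum.swap)
    finally show ?thesis using assms by (simp add: sum_mpow_mult sum_distrib_right[symmetric])
  qed
  have "(\<Sum>c<n. pd a c (pm n (Suc m) c b)) =
      (\<Sum>c<n. \<Sum>k\<le>m. pd a c (mpow n crd k c b) * hs n (m - k)) +
      (\<Sum>c<n. \<Sum>k\<le>m. mpow n crd k c b * pm n (m - k) a c)"
    using assms by (simp add: pm_def[of n "Suc m"] pd_sum pd_mult pd_hs sum.distrib lessThan_Suc_atMost)
  also have "(\<Sum>c<n. \<Sum>k\<le>m. pd a c (mpow n crd k c b) * hs n (m - k)) =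
      (\<Sum>k\<le>m. \<Sum>s<k. tr n (mpow n crd s) * mpow n crd (k - 1 - s) a b * hs n (m - k))"
    by (subst sum.swap) (simp add: 1 sum_distrib_right[symmetric])
  also have "\<dots> = (\<Sum>e<m. \<Sum>s<m - e. mpow n crd e a b * (tr n (mpow n crd s) * hs n (m - 1 - e - s)))"
    by (simp add: sum.Sigma)
      (rule sum.reindex_bij_witness[of _ "\<lambda>(e, s). (e + 1 + s, s)" "\<lambda>(k, s). (k - 1 - s, s)"];
        auto simp: algebra_simps)
  also have "\<dots> = (\<Sum>e<m. of_nat (n + (m - 1 - e)) * (mpow n crd e a b * hs n (m - 1 - e)))"
  proof (rule sum.cong[OF refl])
    fix e assume "e \<in> {..<m}"
    then have "{..<m - e} = {..m - 1 - e}" by auto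
    then show "(\<Sum>s<m - e. mpow n crd e a b * (tr n (mpow n crd s) * hs n (m - 1 - e - s))) =
        of_nat (n + (m - 1 - e)) * (mpow n crd e a b * hs n (m - 1 - e))"
      by (simp only: sum_distrib_left[symmetric] newton0) (simp only: mult.left_commute)
  qed
  also have "(\<Sum>c<n. \<Sum>k\<le>m. mpow n crd k c b * pm n (m - k) a c) =
      (\<Sum>k\<le>m. \<Sum>i<m - k. mpow n crd (i + k) a b * hs n (m - k - 1 - i))"
    by (subst sum.swap) (simp add: 2)
  also have "\<dots> = (\<Sum>e<m. \<Sum>k\<le>e. mpow n crd e a b * hs n (m - 1 - e))"
    by (simp add: sum.Sigma del: sum_constant)
      (rule sum.reindex_bij_witness[of _ "\<lambda>(e, k). (k, e - k)" "\<lambda>(k, i). (i + k, k)"];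
        auto simp: algebra_simps)
  also have "\<dots> = (\<Sum>e<m. of_nat (Suc e) * (mpow n crd e a b * hs n (m - 1 - e)))"
    by (simp del: of_nat_Suc)
  also have "(\<Sum>e<m. of_nat (n + (m - 1 - e)) * (mpow n crd e a b * hs n (m - 1 - e))) + \<dots> =
      (\<Sum>e<m. of_nat (m + n) * (mpow n crd e a b * hs n (m - 1 - e)))"
    unfolding sum.distrib[symmetric] distrib_right[symmetric] of_nat_add[symmetric]
    by (intro sum.cong refl arg_cong2[of _ _ _ _ "(*)"] arg_cong[of _ _ of_nat]) auto
  finally show ?thesis by (simp only: pm_def sum_distrib_left)
qed

subsection \<open>Powers of the matrix of partial derivatives\<close>

primrec dpow :: "nat \<Rightarrow> nat \<Rightarrow> nat \<Rightarrow> nat \<Rightarrow> sg \<Rightarrow> sg" where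
  "dpow n 0 a b F = (if a = b then F else 0)"
| "dpow n (Suc k) a b F = (\<Sum>c<n. dpow n k a c (pd c b F))"

lemma dpow_zero [simp]: "dpow n k a b 0 = 0"
  by (induction k arbitrary: b) simp_all

lemma dpow_add: "dpow n k a b (F + G) = dpow n k a b F + dpow n k a b G"
  by (induction k arbitrary: b F G) (simp_all add: pd_add sum.distrib)

lemma dpow_sum: "dpow n k a b (\<Sum>i\<in>I. f i) = (\<Sum>i\<in>I. dpow n k a b (f i))"
  by (induction I rule: infinite_finite_induct) (simp_all add: dpow_add)

lemma dpow_of_nat_mult: "dpow n k a b (of_nat r * F) = of_nat r * dpow n k a b F"
  by (induction k arbitrary: b F) (simp_all add: pd_of_nat_mult sum_distrib_left)

lemma dpow_pd: "dpow n k a b (pd p q F) = pd p q (dpow n k a b F)"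
  by (induction k arbitrary: b F) (simp_all add: pd_sum pd_commute[of _ _ p q])

text \<open>The entries of D commute as operators, so a power may also be split at its row index.
  The covector side, in \<open>swapN_Suc_right\<close>, needs this form.\<close>

lemma dpow_Suc_left: "\<lbrakk>a < n; b < n\<rbrakk> \<Longrightarrow> dpow n (Suc k) a b F = (\<Sum>c<n. dpow n k c b (pd a c F))"
proof (induction k arbitrary: b F)
  case 0
  have "dpow n (Suc 0) a b F = (\<Sum>c<n. if c = a then pd c b F else 0)"
    by (auto intro: sum.cong)
  also have "\<dots> = pd a b F" using 0 by simp
  also have "\<dots> = (\<Sum>c<n. dpow n 0 c b (pd a c F))" using 0 by simp
  finally show ?case .
next
  case (Suc k)
  have "dpow n (Suc (Suc k)) a b F = (\<Sum>d<n. \<Sum>c<n. dpow n k c d (pd a c (pd d b F)))"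
    using Suc by (subst dpow.simps(2)) (simp del: dpow.simps)
  also have "\<dots> = (\<Sum>c<n. \<Sum>d<n. dpow n k c d (pd a c (pd d b F)))"
    by (rule sum.swap)
  also have "\<dots> = (\<Sum>c<n. dpow n (Suc k) c b (pd a c F))"
    by (simp add: pd_commute[of a])
  finally show ?case .
qed

text \<open>Iterating \<open>pd_pm\<close> lowers the index from \<open>k + m\<close> to
  \<open>m\<close>; the factors picked up form the rising factorial.\<close>

lemma dpow_pm:
  assumes "a < n" "b < n"
  shows "(\<Sum>c<n. dpow n k a c (pm n (k + m) c b)) = cst (pochhammer (of_nat (m + n)) k) * pm n m a b"
proof (induction k)
  case 0
  then show ?case using assms by simp
next
  case (Suc k)
  have "(\<Sum>c<n. dpow n (Suc k) a c (pm n (Suc k + m) c b)) =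
      (\<Sum>c<n. \<Sum>d<n. dpow n k a d (pd d c (pm n (Suc (k + m)) c b)))"
    by simp
  also have "\<dots> = (\<Sum>d<n. dpow n k a d (\<Sum>c<n. pd d c (pm n (Suc (k + m)) c b)))"
    by (subst sum.swap) (simp add: dpow_sum)
  also have "\<dots> = (\<Sum>d<n. of_nat (k + m + n) * dpow n k a d (pm n (k + m) d b))"
    using assms by (intro sum.cong refl) (simp only: pd_pm lessThan_iff dpow_of_nat_mult)
  also have "\<dots> = cst (of_nat (k + m + n)) * (cst (pochhammer (of_nat (m + n)) k) * pm n m a b)"
    by (simp only: sum_distrib_left[symmetric] Suc.IH cst_of_nat)
  also have "\<dots> = cst (pochhammer (of_nat (m + n)) (Suc k)) * pm n m a b"
    by (simp only: mult.assoc[symmetric] cst_mult[symmetric]) (simp add: pochhammer_Suc algebra_simps)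
  finally show ?case .
qed

lemma dpow_hs:
  assumes "a < n" "b < n"
  shows "dpow n (Suc k) a b (hs n (k + m)) = cst (pochhammer (of_nat (m + n)) k) * pm n m a b"
  using assms by (simp add: pd_hs dpow_pm)

subsection \<open>Symmetrization\<close>

lemma sc_commute: "sc c * x = x * sc c"
  by (induction x rule: poly_mapping_single_induct) (simp_all add: sc_def mult_single algebra_simps)

lemma sc_1 [simp]: "sc 1 = 1" and sc_0 [simp]: "sc 0 = 0"
  by (simp_all add: sc_def)

lemma sc_add: "sc (a + b) = sc a + sc b"
  by (simp add: sc_def single_add)

lemma sc_uminus: "sc (- a) = - sc a"
  by (simp add: sc_def single_uminus)

lemma sc_mult: "sc (a * b) = sc a * sc b"
  by (simp add: sc_def mult_single)

lemma sc_sum: "sc (\<Sum>i\<in>I. f i) = (\<Sum>i\<in>I. sc (f i))"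
  by (induction I rule: infinite_finite_induct) (simp_all add: sc_add)

lemma sc_left_commute: "x * (sc c * y) = sc c * (x * y)"
  by (metis mult.assoc sc_commute)

lemma lookup_cst_mult: "Poly_Mapping.lookup (cst c * F) M = c * Poly_Mapping.lookup F M"
  by (induction F rule: poly_mapping_single_induct)
    (auto simp: cst_def mult_single lookup_single lookup_add when_def algebra_simps)

lemma sum_swap22:
  "(\<Sum>p\<in>A. \<Sum>q\<in>B. \<Sum>r\<in>C. \<Sum>s\<in>D. f p q r s) = (\<Sum>r\<in>C. \<Sum>s\<in>D. \<Sum>p\<in>A. \<Sum>q\<in>B. f p q r s)"
  by (simp only: sum.swap[of _ C B] sum.swap[of _ D B] sum.swap[of _ C A] sum.swap[of _ D A])

text \<open>\<open>symN n m\<close> is \<open>m!\<close> times the symmetrization on the homogeneous component of degree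
  \<open>m\<close>, and it vanishes on the other components.\<close>

primrec symN :: "nat \<Rightarrow> nat \<Rightarrow> sg \<Rightarrow> fa" where
  "symN n 0 F = sc (Poly_Mapping.lookup F 0)"
| "symN n (Suc m) F = (\<Sum>p<n. \<Sum>q<n. gE p q * symN n m (pd p q F))"

lemma symN_zero [simp]: "symN n m 0 = 0"
  by (induction m) simp_all

lemma symN_add: "symN n m (F + G) = symN n m F + symN n m G"
  by (induction m arbitrary: F G) (simp_all add: lookup_add sc_add pd_add sum.distrib algebra_simps)

lemma symN_sum: "symN n m (\<Sum>i\<in>I. f i) = (\<Sum>i\<in>I. symN n m (f i))"
  by (induction I rule: infinite_finite_induct) (simp_all add: symN_add)

lemma symN_cst_mult: "symN n m (cst c * F) = sc c * symN n m F"
  by (induction m arbitrary: F)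
    (simp_all add: lookup_cst_mult sc_mult pd_cst_mult sum_distrib_left sc_left_commute)

lemma symN_uminus: "symN n m (- F) = - symN n m F"
  using symN_add[of n m F "- F"] by (simp add: eq_neg_iff_add_eq_0 add.commute)

lemma symN_diff: "symN n m (F - G) = symN n m F - symN n m G"
  using symN_add[of n m F "- G"] by (simp add: symN_uminus)

text \<open>Since partial derivatives commute, the last factor can be split off instead of the
  first. This serves for covectors, which are met from the right.\<close>

lemma symN_Suc_right: "symN n (Suc m) F = (\<Sum>p<n. \<Sum>q<n. symN n m (pd p q F) * gE p q)"
proof (induction m arbitrary: F)
  case 0
  then show ?case by (simp add: sc_commute)
next
  case (Suc m)
  have "symN n (Suc (Suc m)) F =
      (\<Sum>p<n. \<Sum>q<n. \<Sum>r<n. \<Sum>s<n. gE p q * symN n m (pd p q (pd r s F)) * gE r s)"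
    by (subst symN.simps(2), subst Suc.IH) (simp add: sum_distrib_left mult.assoc pd_commute)
  also have "\<dots> = (\<Sum>r<n. \<Sum>s<n. \<Sum>p<n. \<Sum>q<n. gE p q * symN n m (pd p q (pd r s F)) * gE r s)"
    by (rule sum_swap22)
  finally show ?case by (simp add: sum_distrib_right)
qed

section \<open>Symmetrization as a sum over the orderings of the factors\<close>

lemma sum_permutations_of_set:
  assumes "finite S" "S \<noteq> {}"
  shows "(\<Sum>xs\<in>permutations_of_set S. f xs) = (\<Sum>x\<in>S. \<Sum>xs\<in>permutations_of_set (S - {x}). f (x # xs))"
proof -
  have "(\<Sum>xs\<in>permutations_of_set S. f xs) = (\<Sum>x\<in>S. \<Sum>xs\<in>(#) x ` permutations_of_set (S - {x}). f xs)"
    unfolding permutations_of_set_nonempty[OF assms(2)]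
    using assms(1) by (intro sum.UNION_disjoint) auto
  then show ?thesis by (simp add: sum.reindex)
qed

text \<open>By the product rule each derivative selects the factor that is written first. Indexing
  the factors by \<open>S\<close> keeps repeated variables apart, so every ordering is
  counted.\<close>

lemma symN_prod:
  assumes "finite S" "\<And>i. i \<in> S \<Longrightarrow> x i < n \<and> y i < n"
  shows "symN n (card S) (\<Prod>i\<in>S. var (x i) (y i)) =
    (\<Sum>xs\<in>permutations_of_set S. prod_list (map (\<lambda>i. gE (x i) (y i)) xs))"
  using assms
proof (induction "card S" arbitrary: S)
  case 0
  then have "S = {}" by simp
  then show ?case by (simp add: lookup_one)
next
  case (Suc m)
  let ?F = "\<lambda>S. \<Prod>i\<in>S. var (x i) (y i)" and ?R = "\<lambda>S. \<Sum>xs\<in>permutations_of_set S. prod_list (map (\<lambda>i. gE (x i) (y i)) xs)"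
  have IH: "symN n m (?F (S - {i})) = ?R (S - {i})" if "i \<in> S" for i
  proof -
    have "m = card (S - {i})" using Suc that by simp
    then show ?thesis using Suc.hyps(1)[of "S - {i}"] Suc.prems by simp
  qed
  have "symN n (card S) (?F S) = (\<Sum>p<n. \<Sum>q<n. gE p q * symN n m (pd p q (?F S)))"
    using Suc.hyps(2)[symmetric] by simp
  also have "\<dots> = (\<Sum>p<n. \<Sum>q<n. \<Sum>i\<in>S. if p = x i \<and> q = y i then gE p q * ?R (S - {i}) else 0)"
  proof (intro sum.cong refl)
    fix p q
    have "gE p q * symN n m (pd p q (?F S)) =
        (\<Sum>i\<in>S. gE p q * symN n m ((if p = x i \<and> q = y i then 1 else 0) * ?F (S - {i})))"
      using Suc.prems by (simp add: pd_prod pd_var symN_sum sum_distrib_left)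
    also have "\<dots> = (\<Sum>i\<in>S. if p = x i \<and> q = y i then gE p q * ?R (S - {i}) else 0)"
      by (intro sum.cong) (auto simp: IH)
    finally show "gE p q * symN n m (pd p q (?F S)) = \<dots>" .
  qed
  also have "\<dots> = (\<Sum>i\<in>S. \<Sum>p<n. \<Sum>q<n. if p = x i \<and> q = y i then gE p q * ?R (S - {i}) else 0)"
    by (simp only: sum.swap[of _ S])
  also have "\<dots> = (\<Sum>i\<in>S. gE (x i) (y i) * ?R (S - {i}))"
  proof (intro sum.cong refl)
    fix i assume i: "i \<in> S"
    have "(\<Sum>p<n. \<Sum>q<n. if p = x i \<and> q = y i then gE p q * ?R (S - {i}) else 0) =
        (\<Sum>p<n. if p = x i then \<Sum>q<n. if q = y i then gE p q * ?R (S - {i}) else 0 else 0)"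
      by (intro sum.cong) auto
    then show "(\<Sum>p<n. \<Sum>q<n. if p = x i \<and> q = y i then gE p q * ?R (S - {i}) else 0) = gE (x i) (y i) * ?R (S - {i})"
      using Suc.prems(2)[OF i] by simp
  qed
  also have "\<dots> = ?R S"
    using Suc by (subst sum_permutations_of_set[of S]) (auto simp: sum_distrib_left)
  finally show ?case .
qed

lemma bij_betw_permutes_permutations_of_set:
  "bij_betw (\<lambda>p. map p [0..<m]) {p. p permutes {..<m}} (permutations_of_set {..<m})"
proof -
  have inj: "inj_on (\<lambda>p. map p [0..<m]) {p. p permutes {..<m}}"
  proof (rule inj_onI, rule ext)
    fix p q k assume "p \<in> {p. p permutes {..<m}}" "q \<in> {p. p permutes {..<m}}" "map p [0..<m] = map q [0..<m]"
    then show "p k = q k" by (cases "k < m") (auto simp: permutes_def)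
  qed
  have sub: "(\<lambda>p. map p [0..<m]) ` {p. p permutes {..<m}} \<subseteq> permutations_of_set {..<m}"
    by (auto simp: distinct_map permutes_inj_on atLeast0LessThan permutes_image intro!: permutations_of_setI)
  have "card ((\<lambda>p. map p [0..<m]) ` {p. p permutes {..<m}}) = card (permutations_of_set {..<m})"
    using card_permutations[of "{..<m}" m] by (simp add: card_image[OF inj])
  then show ?thesis
    using inj sub by (simp add: bij_betw_def card_subset_eq)
qed

text \<open>The bridge from \<open>Sym\<close>, defined on lists in the free algebra, to
  \<open>symN\<close>, which sees only the commutative product of the factors.\<close>

lemma Sym_coordL:
  assumes "\<And>a b. (a, b) \<in> set vs \<Longrightarrow> a < n \<and> b < n"
  shows "Sym (map (\<lambda>(a, b). coordL a b) vs) =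
    sc (1 / fact (length vs)) * symN n (length vs) (prod_list (map (\<lambda>(a, b). crd a b) vs))"
proof -
  let ?m = "length vs" and ?us = "map (\<lambda>(a, b). coordL a b) vs"
  have "(\<Sum>p | p permutes {..<?m}. prod_list (map (\<lambda>k. ?us ! p k) [0..<?m])) =
      (\<Sum>p | p permutes {..<?m}. prod_list (map (\<lambda>i. gE (snd (vs ! i)) (fst (vs ! i))) (map p [0..<?m])))"
  proof (intro sum.cong refl arg_cong[of _ _ prod_list])
    fix p assume "p \<in> {p. p permutes {..<?m}}"
    then have "p k < ?m" if "k < ?m" for k
      using that permutes_in_image[of p "{..<?m}" k] by simp
    then show "map (\<lambda>k. ?us ! p k) [0..<?m] = map (\<lambda>i. gE (snd (vs ! i)) (fst (vs ! i))) (map p [0..<?m])"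
      by (simp add: coordL_def case_prod_unfold)
  qed
  also have "\<dots> = (\<Sum>xs\<in>permutations_of_set {..<?m}. prod_list (map (\<lambda>i. gE (snd (vs ! i)) (fst (vs ! i))) xs))"
    by (rule sum.reindex_bij_betw[OF bij_betw_permutes_permutations_of_set])
  also have "\<dots> = symN n (card {..<?m}) (\<Prod>i<?m. var (snd (vs ! i)) (fst (vs ! i)))"
  proof (rule symN_prod[symmetric])
    show "snd (vs ! i) < n \<and> fst (vs ! i) < n" if "i \<in> {..<?m}" for i
      using that assms[of "fst (vs ! i)" "snd (vs ! i)"] by simp
  qed simp
  also have "(\<Prod>i<?m. var (snd (vs ! i)) (fst (vs ! i))) = prod_list (map (\<lambda>(a, b). crd a b) vs)"
    by (simp add: prod.list_conv_set_nth atLeast0LessThan crd_def case_prod_unfold)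
  finally show ?thesis by (simp add: Sym_def)
qed

section \<open>Index sums as traces and matrix powers\<close>

lemma sum_idx: "(\<Sum>js\<in>idx n m. f (\<lambda>t. if t < m then js ! t else undefined)) = (\<Sum>j\<in>{..<m} \<rightarrow>\<^sub>E {..<n}. f j)"
\<comment> \<open>The value \<open>undefined\<close> from \<open>m\<close> on makes the functions
  extensional, as \<open>PiE\<close> demands.\<close>
proof (rule sum.reindex_bij_witness[of _ "\<lambda>j. map j [0..<m]" "\<lambda>js t. if t < m then js ! t else undefined"])
  fix js assume js: "js \<in> idx n m"
  then show "map (\<lambda>t. if t < m then js ! t else undefined) [0..<m] = js"
    by (auto simp: idx_def intro: nth_equalityI)
  show "(\<lambda>t. if t < m then js ! t else undefined) \<in> {..<m} \<rightarrow>\<^sub>E {..<n}"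
    using js by (auto simp: idx_def PiE_def extensional_def dest!: subsetD[OF _ nth_mem])
next
  fix j assume j: "j \<in> {..<m} \<rightarrow>\<^sub>E {..<n}"
  then show "(\<lambda>t. if t < m then map j [0..<m] ! t else undefined) = j"
    by (auto simp: PiE_def extensional_def)
  show "map j [0..<m] \<in> idx n m"
    using PiE_mem[OF j] by (auto simp: idx_def)
qed simp

text \<open>Here the permutation formula for the trace of the symmetric power meets the definition
  of \<open>hs\<close> by Newton's identity.\<close>

lemma sum_trS: "(\<Sum>\<sigma> | \<sigma> permutes {..<m}. \<Sum>js\<in>idx n m. \<Prod>t<m. crd (js ! t) (js ! \<sigma> t)) = fact m * hs n m"
proof -
  have "(\<Sum>\<sigma> | \<sigma> permutes {..<m}. \<Sum>js\<in>idx n m. \<Prod>t<m. crd (js ! t) (js ! \<sigma> t)) = cycle_sum n crd {..<m}"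
    unfolding cycle_sum_def
  proof (rule sum.cong[OF refl])
    fix \<sigma> assume "\<sigma> \<in> {\<sigma>. \<sigma> permutes {..<m}}"
    then have "\<sigma> t < m" if "t < m" for t
      using that permutes_in_image[of \<sigma> "{..<m}" t] by simp
    then show "(\<Sum>js\<in>idx n m. \<Prod>t<m. crd (js ! t) (js ! \<sigma> t)) = (\<Sum>j\<in>{..<m} \<rightarrow>\<^sub>E {..<n}. \<Prod>t<m. crd (j t) (j (\<sigma> t)))"
      by (subst sum_idx[symmetric]) simp
  qed
  also have "\<dots> = fact (card {..<m}) * hs n (card {..<m})"
    by (rule cycle_sum_newton[OF _ hs_Suc]) simp_all
  finally show ?thesis by simp
qed

lemma sum_paths:
  assumes "a < n" "b < n"
  shows "(\<Sum>is\<in>paths n a b k. \<Prod>t<k. crd (is ! t) (is ! Suc t)) = mpow n crd k a b"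
  using assms(1)
proof (induction k arbitrary: a)
  case 0
  have "paths n a b 0 = (if a = b then {[a]} else {})"
    using 0 assms by (auto simp: paths_def length_Suc_conv)
  then show ?case by simp
next
  case (Suc k)
  have "(\<Sum>is\<in>paths n a b (Suc k). \<Prod>t<Suc k. crd (is ! t) (is ! Suc t)) =
      (\<Sum>(c, is)\<in>Sigma {..<n} (\<lambda>c. paths n c b k). crd a c * (\<Prod>t<k. crd (is ! t) (is ! Suc t)))"
  proof (rule sum.reindex_bij_witness[of _ "\<lambda>(c, is). a # is" "\<lambda>is. (hd (tl is), tl is)"])
    fix "is" assume "is \<in> paths n a b (Suc k)"
    then obtain c is' where is': "is = a # c # is'" "length is' = k" "c < n" "set is' \<subseteq> {..<n}" "last (c # is') = b"
      by (auto simp: paths_def length_Suc_conv split: if_splits)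
    show "(case (hd (tl is), tl is) of (c, is) \<Rightarrow> a # is) = is"
      and "(hd (tl is), tl is) \<in> Sigma {..<n} (\<lambda>c. paths n c b k)"
      using is' by (auto simp: paths_def)
    show "(case (hd (tl is), tl is) of (c, is) \<Rightarrow> crd a c * (\<Prod>t<k. crd (is ! t) (is ! Suc t))) =
        (\<Prod>t<Suc k. crd (is ! t) (is ! Suc t))"
      using is' by (subst prod.lessThan_Suc_shift) simp
  next
    fix ci assume "ci \<in> Sigma {..<n} (\<lambda>c. paths n c b k)"
    then obtain c "is" where ci: "ci = (c, is)" "c < n" "is \<in> paths n c b k" by auto
    then have "is \<noteq> []" by (auto simp: paths_def)
    then show "(hd (tl (case ci of (c, is) \<Rightarrow> a # is)), tl (case ci of (c, is) \<Rightarrow> a # is)) = ci"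
      and "(case ci of (c, is) \<Rightarrow> a # is) \<in> paths n a b (Suc k)"
      using ci Suc.prems by (auto simp: paths_def)
  qed
  also have "\<dots> = (\<Sum>c<n. crd a c * mpow n crd k c b)"
  proof -
    have "finite (paths n c b k)" for c
      by (rule finite_subset[of _ "{is. set is \<subseteq> {..<n} \<and> length is = Suc k}"])
        (auto simp: paths_def intro!: finite_lists_length_eq)
    then show ?thesis
      by (simp add: sum.Sigma[symmetric] sum_distrib_left[symmetric] Suc.IH)
  qed
  finally show ?case by (simp add: mpow.simps mmul_def)
qed

lemma trS_factors_eq: "trS_factors js \<sigma> m = map (\<lambda>(a, b). coordL a b) (map (\<lambda>t. (js ! t, js ! \<sigma> t)) [0..<m])"
  and path_factors_eq: "path_factors is m = map (\<lambda>(a, b). coordL a b) (map (\<lambda>t. (is ! t, is ! Suc t)) [0..<m])"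
  by (simp_all add: trS_factors_def path_factors_def)

lemma prod_list_map_upt: "prod_list (map f [0..<m]) = (\<Prod>t<m. f t :: 'a::comm_monoid_mult)"
  by (simp add: prod.list_conv_set_nth atLeast0LessThan)

lemma nth_idx_less:
  assumes "js \<in> idx n m" "\<sigma> permutes {..<m}" "t < m"
  shows "js ! t < n" "js ! \<sigma> t < n"
proof -
  have "\<sigma> t < m" using assms permutes_in_image[of \<sigma> "{..<m}" t] by simp
  then have "js ! t \<in> set js" "js ! \<sigma> t \<in> set js" using assms by (auto simp: idx_def)
  moreover have "set js \<subseteq> {..<n}" using assms by (simp add: idx_def)
  ultimately show "js ! t < n" "js ! \<sigma> t < n" by blast+
qed

text \<open>Of the two factors 1/m!, one from \<open>Sym\<close> and one from the trace formula, the
  second cancels against \<open>sum_trS\<close>.\<close>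

lemma SymTrS_eq: "SymTrS n m = sc (1 / fact m) * symN n m (hs n m)"
proof -
  have "SymTrS n m = (\<Sum>\<sigma> | \<sigma> permutes {..<m}. \<Sum>js\<in>idx n m.
      sc (1 / fact m) * (sc (1 / fact m) * symN n m (\<Prod>t<m. crd (js ! t) (js ! \<sigma> t))))"
    unfolding SymTrS_def trS_factors_eq
    by (intro sum.cong refl, subst Sym_coordL[where n = n])
      (auto simp: nth_idx_less prod_list_map_upt[symmetric] comp_def)
  also have "\<dots> = sc (1 / fact m) * (sc (1 / fact m) * symN n m (fact m * hs n m))"
    by (simp only: sum_distrib_left[symmetric] symN_sum[symmetric] sum_trS)
  also have "fact m * hs n m = cst (fact m) * hs n m"
    by (metis cst_of_nat of_nat_fact)
  finally show ?thesis
    by (simp add: symN_cst_mult mult.assoc[symmetric] sc_mult[symmetric])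
qed

lemma SymPT_eq:
  assumes "a < n" "b < n"
  shows "SymPT n k l a b = sc (1 / fact (k + l)) * symN n (k + l) (mpow n crd k a b * hs n l)"
proof -
  have "SymPT n k l a b = (\<Sum>is\<in>paths n a b k. \<Sum>\<sigma> | \<sigma> permutes {..<l}. \<Sum>js\<in>idx n l.
      sc (1 / fact l) * (sc (1 / fact (k + l)) *
        symN n (k + l) ((\<Prod>t<k. crd (is ! t) (is ! Suc t)) * (\<Prod>t<l. crd (js ! t) (js ! \<sigma> t)))))"
    unfolding SymPT_def trS_factors_eq path_factors_eq map_append[symmetric]
  proof (intro sum.cong refl)
    fix "is" \<sigma> js assume "is": "is \<in> paths n a b k" and "\<sigma> \<in> {\<sigma>. \<sigma> permutes {..<l}}" "js \<in> idx n l"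
    moreover have "is ! t < n" "is ! Suc t < n" if "t < k" for t
      using "is" that by (auto simp: paths_def subset_iff)
    ultimately show "sc (1 / fact l) * Sym (map (\<lambda>(a, b). coordL a b)
          (map (\<lambda>t. (is ! t, is ! Suc t)) [0..<k] @ map (\<lambda>t. (js ! t, js ! \<sigma> t)) [0..<l])) =
        sc (1 / fact l) * (sc (1 / fact (k + l)) *
        symN n (k + l) ((\<Prod>t<k. crd (is ! t) (is ! Suc t)) * (\<Prod>t<l. crd (js ! t) (js ! \<sigma> t))))"
      by (subst Sym_coordL[where n = n]) (auto simp: nth_idx_less prod_list_map_upt[symmetric] comp_def)
  qed
  also have "\<dots> = sc (1 / fact l) * (sc (1 / fact (k + l)) * symN n (k + l) (mpow n crd k a b * (fact l * hs n l)))"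
    by (simp only: sum_distrib_left[symmetric] symN_sum[symmetric] sum_trS sum_distrib_right[symmetric] sum_paths[OF assms])
  also have "mpow n crd k a b * (fact l * hs n l) = cst (fact l) * (mpow n crd k a b * hs n l)"
    by (metis cst_of_nat of_nat_fact mult.left_commute)
  finally show ?thesis
    by (simp only: symN_cst_mult) (simp add: mult.assoc[symmetric] sc_mult[symmetric])
qed

lemma r_el_eq:
  assumes "a < n" "b < n"
  shows "r_el n j b a = sc (1 / fact j) * symN n j (pm n (Suc j) a b)"
  using assms
  by (simp add: r_el_def SymPT_eq pm_def lessThan_Suc_atMost symN_sum sum_distrib_left)

subsection \<open>Congruence modulo a two-sided ideal\<close>

definition eqm :: "fa set \<Rightarrow> fa \<Rightarrow> fa \<Rightarrow> bool" where
  "eqm R a b \<longleftrightarrow> a - b \<in> tideal R"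

lemma tideal_uminus: "a \<in> tideal R \<Longrightarrow> - a \<in> tideal R"
  using tideal.mult[of a R "- 1" 1] by simp

lemma tideal_mult_left: "a \<in> tideal R \<Longrightarrow> u * a \<in> tideal R"
  using tideal.mult[of a R u 1] by simp

lemma tideal_mult_right: "a \<in> tideal R \<Longrightarrow> a * u \<in> tideal R"
  using tideal.mult[of a R 1 u] by simp

lemma tideal_diff: "a \<in> tideal R \<Longrightarrow> b \<in> tideal R \<Longrightarrow> a - b \<in> tideal R"
  using tideal.add[of a R "- b"] tideal_uminus[of b R] by simp

lemma tideal_mono:
  assumes "R \<subseteq> R'" "a \<in> tideal R"
  shows "a \<in> tideal R'"
  using assms(2) by induction (use assms(1) in \<open>auto intro: tideal.intros\<close>)

lemma eqm_mono: "R \<subseteq> R' \<Longrightarrow> eqm R a b \<Longrightarrow> eqm R' a b"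
  by (auto simp: eqm_def intro: tideal_mono)

lemma eqm_refl [simp]: "eqm R a a"
  by (simp add: eqm_def tideal.zero)

lemma eqm_trans [trans]: "eqm R a b \<Longrightarrow> eqm R b c \<Longrightarrow> eqm R a c"
  unfolding eqm_def using tideal.add[of "a - b" R "b - c"] by simp

lemma eq_eqm_trans [trans]: "a = b \<Longrightarrow> eqm R b c \<Longrightarrow> eqm R a c"
  and eqm_eq_trans [trans]: "eqm R a b \<Longrightarrow> b = c \<Longrightarrow> eqm R a c"
  by simp_all

lemma eqm_add: "eqm R a b \<Longrightarrow> eqm R c d \<Longrightarrow> eqm R (a + c) (b + d)"
  unfolding eqm_def by (drule (1) tideal.add) (simp add: algebra_simps)

lemma eqm_uminus: "eqm R a b \<Longrightarrow> eqm R (- a) (- b)"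
  unfolding eqm_def by (drule tideal_uminus) (simp add: algebra_simps)

lemma eqm_diff: "eqm R a b \<Longrightarrow> eqm R c d \<Longrightarrow> eqm R (a - c) (b - d)"
  using eqm_add[of R a b "- c" "- d"] by (simp add: eqm_uminus)

lemma eqm_mult_left: "eqm R a b \<Longrightarrow> eqm R (u * a) (u * b)"
  unfolding eqm_def by (drule tideal_mult_left[where u = u]) (simp add: algebra_simps)

lemma eqm_mult_right: "eqm R a b \<Longrightarrow> eqm R (a * u) (b * u)"
  unfolding eqm_def by (drule tideal_mult_right[where u = u]) (simp add: algebra_simps)

lemma eqm_sum: "(\<And>i. i \<in> I \<Longrightarrow> eqm R (f i) (g i)) \<Longrightarrow> eqm R (\<Sum>i\<in>I. f i) (\<Sum>i\<in>I. g i)"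
  by (induction I rule: infinite_finite_induct) (simp_all add: eqm_add)

lemma sum_kd_left: "i < n \<Longrightarrow> (\<Sum>k<n. kd i k * f k) = f i"
  and sum_kd_right: "i < n \<Longrightarrow> (\<Sum>k<n. kd k i * f k) = f i"
  by (simp_all add: kd_def if_distrib[of "\<lambda>x. x * _"] cong: if_cong)

lemma kd_left_commute: "x * (kd i j * y) = kd i j * (x * y)"
  by (simp add: kd_def)

lemma comm_mult_right: "comm a (b * c) = comm a b * c + b * comm a c"
  by (simp add: comm_def algebra_simps)

lemma comm_mult_left: "comm (a * b) c = a * comm b c + comm a c * b"
  by (simp add: comm_def algebra_simps)

lemma comm_add_right: "comm a (b + c) = comm a b + comm a c"
  by (simp add: comm_def algebra_simps)

lemma comm_add_left: "comm (a + b) c = comm a c + comm b c"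
  by (simp add: comm_def algebra_simps)

lemma comm_sum_right: "comm a (\<Sum>i\<in>I. f i) = (\<Sum>i\<in>I. comm a (f i))"
  by (simp add: comm_def sum_distrib_left sum_distrib_right sum_subtractf)

lemma comm_sc_left [simp]: "comm (sc c) x = 0"
  by (simp add: comm_def sc_commute)

lemma comm_sc_mult_right: "comm a (sc c * b) = sc c * comm a b"
  by (simp add: comm_def sc_left_commute mult.assoc right_diff_distrib)

lemma eqm_zero_iff: "eqm R a 0 \<longleftrightarrow> a \<in> tideal R"
  by (simp add: eqm_def)

subsection \<open>Moving a vector or covector through a symmetrized product\<close>

text \<open>Heuristically \<open>y\<^sub>b e\<^sup>L = \<Sum>\<^sub>a e\<^sup>L (e\<^sup>-\<^sup>L)\<^sub>a\<^sub>b y\<^sub>a\<close> for \<open>L\<close> in \<open>gl\<^sub>n\<close>, and the entries of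
  \<open>L\<close> act on symmetrized polynomials as the partial derivatives. So \<open>swapN\<close> is
  \<open>m!\<close> times the symmetrization of \<open>(e\<^sup>-\<^sup>D)\<^sub>a\<^sub>b F\<close> for \<open>F\<close> homogeneous of degree \<open>m\<close>.\<close>

definition swapN :: "nat \<Rightarrow> nat \<Rightarrow> nat \<Rightarrow> nat \<Rightarrow> sg \<Rightarrow> fa" where
  "swapN n m a b F = (\<Sum>k\<le>m. symN n (m - k) (cst ((- 1) ^ k * of_nat (m choose k)) * dpow n k a b F))"

text \<open>Pascal's rule for the signed binomials \<open>c\<close>: the alternating sign turns the
  sum into a difference. The first part keeps the power of D and raises the degree of
  symmetrization, the second has one more D.\<close>

lemma swapN_pascal:
  "swapN n (Suc m) a b F =
    (\<Sum>k\<le>m. symN n (Suc (m - k)) (cst ((- 1) ^ k * of_nat (m choose k)) * dpow n k a b F))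
    - (\<Sum>k\<le>m. symN n (m - k) (cst ((- 1) ^ k * of_nat (m choose k)) * dpow n (Suc k) a b F))"
proof -
  define c :: "nat \<Rightarrow> nat \<Rightarrow> complex" where "c m k = (- 1) ^ k * of_nat (m choose k)" for m k
  have c: "c (Suc m) 0 = 1" "c m 0 = 1" "c (Suc m) (Suc k) = c m (Suc k) - c m k" "c m (Suc m) = 0" for k
    by (simp_all add: c_def algebra_simps)
  have cst_diff: "cst (x - y) * G = cst x * G - cst y * G" for x y G
    by (metis add_diff_cancel_right' cst_add diff_add_cancel left_diff_distrib)
  have "swapN n (Suc m) a b F = symN n (Suc m) (dpow n 0 a b F)
      + (\<Sum>k\<le>m. symN n (m - k) (cst (c (Suc m) (Suc k)) * dpow n (Suc k) a b F))"
    unfolding swapN_def c_def[symmetric] by (subst sum.atMost_Suc_shift) (simp only: c cst_1 mult_1_left diff_zero diff_Suc_Suc)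
  also have "\<dots> = (symN n (Suc m) (dpow n 0 a b F)
      + (\<Sum>k\<le>m. symN n (m - k) (cst (c m (Suc k)) * dpow n (Suc k) a b F)))
      - (\<Sum>k\<le>m. symN n (m - k) (cst (c m k) * dpow n (Suc k) a b F))"
    by (simp only: c cst_diff symN_diff sum_subtractf) (rule add_diff_eq)
  also have "symN n (Suc m) (dpow n 0 a b F)
      + (\<Sum>k\<le>m. symN n (m - k) (cst (c m (Suc k)) * dpow n (Suc k) a b F)) =
      (\<Sum>k\<le>Suc m. symN n (Suc m - k) (cst (c m k) * dpow n k a b F))"
    by (subst sum.atMost_Suc_shift) (simp only: c cst_1 mult_1_left diff_zero diff_Suc_Suc)
  also have "\<dots> = (\<Sum>k\<le>m. symN n (Suc (m - k)) (cst (c m k) * dpow n k a b F))"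
    by (simp only: sum.atMost_Suc c cst_0 mult_zero_left symN_zero add_0_right)
      (rule sum.cong; simp add: Suc_diff_le)
  finally show ?thesis by (simp only: c_def)
qed

text \<open>This recursion mirrors the relation y_b e_pq = e_pq y_b - delta_qb y_p, applied to the
  leftmost factor.\<close>

lemma swapN_Suc:
  "swapN n (Suc m) a b F =
    (\<Sum>p<n. \<Sum>q<n. gE p q * swapN n m a b (pd p q F)) - (\<Sum>p<n. swapN n m a p (pd p b F))"
proof -
  have "(\<Sum>p<n. \<Sum>q<n. gE p q * swapN n m a b (pd p q F)) =
      (\<Sum>k\<le>m. \<Sum>p<n. \<Sum>q<n. gE p q * symN n (m - k) (cst ((- 1) ^ k * of_nat (m choose k)) * pd p q (dpow n k a b F)))"
    by (simp only: swapN_def sum_distrib_left sum.swap[of _ "{..m}"] dpow_pd)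
  moreover have "(\<Sum>p<n. swapN n m a p (pd p b F)) =
      (\<Sum>k\<le>m. \<Sum>p<n. symN n (m - k) (cst ((- 1) ^ k * of_nat (m choose k)) * dpow n k a p (pd p b F)))"
    by (simp only: swapN_def sum.swap[of _ "{..m}"])
  ultimately show ?thesis
    by (simp add: swapN_pascal pd_cst_mult symN_sum sum_distrib_left)
qed

text \<open>The mirror image for covectors, matching e_pq x_b = x_b e_pq - delta_pb x_q at the
  rightmost factor.\<close>

lemma swapN_Suc_right:
  assumes "a < n" "b < n"
  shows "swapN n (Suc m) b a F =
    (\<Sum>p<n. \<Sum>q<n. swapN n m b a (pd p q F) * gE p q) - (\<Sum>q<n. swapN n m q a (pd b q F))"
proof -
  have "(\<Sum>p<n. \<Sum>q<n. swapN n m b a (pd p q F) * gE p q) =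
      (\<Sum>k\<le>m. \<Sum>p<n. \<Sum>q<n. symN n (m - k) (cst ((- 1) ^ k * of_nat (m choose k)) * pd p q (dpow n k b a F)) * gE p q)"
    by (simp only: swapN_def sum_distrib_right sum.swap[of _ "{..m}"] dpow_pd)
  moreover have "(\<Sum>q<n. swapN n m q a (pd b q F)) =
      (\<Sum>k\<le>m. \<Sum>q<n. symN n (m - k) (cst ((- 1) ^ k * of_nat (m choose k)) * dpow n k q a (pd b q F)))"
    by (simp only: swapN_def sum.swap[of _ "{..m}"])
  ultimately show ?thesis
    using assms
    by (simp add: swapN_pascal symN_Suc_right dpow_Suc_left pd_cst_mult symN_sum sum_distrib_left del: dpow.simps symN.simps)
qed

section \<open>Defining relations as congruences, and induction on the degree\<close>

lemma eqm_gE_gE: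
  "\<lbrakk>i < n; j < n; k < n; l < n\<rbrakk> \<Longrightarrow> eqm (relsU n) (comm (gE i j) (gE k l)) (kd j k * gE i l - kd l i * gE k j)"
  unfolding eqm_def by (rule tideal.base) (unfold relsU_def, blast)

lemma eqm_gE_gY:
  "\<lbrakk>i < n; j < n; k < n\<rbrakk> \<Longrightarrow> eqm (relsH n \<zeta>) (comm (gE i j) (gY k)) (kd j k * gY i)"
  unfolding eqm_def by (rule tideal.base) (unfold relsH_def, blast)

lemma eqm_gE_gX:
  "\<lbrakk>i < n; j < n; k < n\<rbrakk> \<Longrightarrow> eqm (relsH n \<zeta>) (comm (gE i j) (gX k)) (- (kd i k * gX j))"
  unfolding eqm_def diff_minus_eq_add by (rule tideal.base) (unfold relsH_def, blast)

lemma eqm_gX_gX: "\<lbrakk>a < n; b < n\<rbrakk> \<Longrightarrow> eqm (relsH n \<zeta>) (comm (gX a) (gX b)) 0"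
  unfolding eqm_def diff_zero by (rule tideal.base) (unfold relsH_def, blast)

lemma eqm_gY_gY: "\<lbrakk>a < n; b < n\<rbrakk> \<Longrightarrow> eqm (relsH n \<zeta>) (comm (gY a) (gY b)) 0"
  unfolding eqm_def diff_zero by (rule tideal.base) (unfold relsH_def, blast)

lemma eqm_gY_gX:
  "\<lbrakk>a < n; b < n\<rbrakk> \<Longrightarrow> eqm (relsH n \<zeta>) (comm (gY b) (gX a)) (\<Sum>j\<le>degree \<zeta>. sc (coeff \<zeta> j) * r_el n j b a)"
  unfolding eqm_def by (rule tideal.base) (unfold relsH_def, blast)

text \<open>Induction on the degree: the vector passes the leftmost matrix unit, and
  \<open>swapN_Suc\<close> reassembles the resulting terms.\<close>

lemma gY_symN:
  assumes "b < n"
  shows "eqm (relsH n \<zeta>) (gY b * symN n m F) (\<Sum>a<n. swapN n m a b F * gY a)"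
  using assms
proof (induction m arbitrary: b F)
  case 0
  have "(\<Sum>a<n. swapN n 0 a b F * gY a) = (\<Sum>a<n. if a = b then symN n 0 F * gY a else 0)"
    by (rule sum.cong) (auto simp: swapN_def)
  also have "\<dots> = gY b * symN n 0 F"
    using 0 by (simp add: sc_commute)
  finally show ?case by simp
next
  case (Suc m)
  let ?R = "relsH n \<zeta>"
  have yE: "eqm ?R (gY b * gE p q) (gE p q * gY b - kd q b * gY p)" if "p < n" "q < n" for p q
    using eqm_diff[OF eqm_refl[of _ "gE p q * gY b"] eqm_gE_gY[OF that Suc.prems(1)]] by (simp add: comm_def)
  have "gY b * symN n (Suc m) F = (\<Sum>p<n. \<Sum>q<n. gY b * gE p q * symN n m (pd p q F))"
    by (simp add: sum_distrib_left mult.assoc)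
  also have "eqm ?R \<dots> (\<Sum>p<n. \<Sum>q<n. (gE p q * gY b - kd q b * gY p) * symN n m (pd p q F))"
    by (intro eqm_sum eqm_mult_right yE) auto
  also have "\<dots> = (\<Sum>p<n. \<Sum>q<n. gE p q * (gY b * symN n m (pd p q F)))
      - (\<Sum>p<n. \<Sum>q<n. kd q b * (gY p * symN n m (pd p q F)))"
    by (simp add: sum_subtractf left_diff_distrib mult.assoc)
  also have "(\<Sum>p<n. \<Sum>q<n. kd q b * (gY p * symN n m (pd p q F))) = (\<Sum>p<n. gY p * symN n m (pd p b F))"
    using Suc.prems by (simp add: sum_kd_right)
  also have "eqm ?R ((\<Sum>p<n. \<Sum>q<n. gE p q * (gY b * symN n m (pd p q F))) - (\<Sum>p<n. gY p * symN n m (pd p b F)))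
      ((\<Sum>p<n. \<Sum>q<n. gE p q * (\<Sum>a<n. swapN n m a b (pd p q F) * gY a)) - (\<Sum>p<n. \<Sum>a<n. swapN n m a p (pd p b F) * gY a))"
    using Suc.prems by (intro eqm_diff eqm_sum eqm_mult_left Suc.IH) auto
  also have "(\<Sum>p<n. \<Sum>q<n. gE p q * (\<Sum>a<n. swapN n m a b (pd p q F) * gY a)) =
      (\<Sum>a<n. \<Sum>p<n. \<Sum>q<n. gE p q * swapN n m a b (pd p q F) * gY a)"
    (is "?l = _")
  proof -
    have "?l = (\<Sum>p<n. \<Sum>a<n. \<Sum>q<n. gE p q * swapN n m a b (pd p q F) * gY a)"
      by (simp only: sum_distrib_left mult.assoc) (intro sum.cong refl sum.swap)
    also have "\<dots> = (\<Sum>a<n. \<Sum>p<n. \<Sum>q<n. gE p q * swapN n m a b (pd p q F) * gY a)"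
      by (rule sum.swap)
    finally show ?thesis .
  qed
  also have "(\<Sum>p<n. \<Sum>a<n. swapN n m a p (pd p b F) * gY a) = (\<Sum>a<n. \<Sum>p<n. swapN n m a p (pd p b F) * gY a)"
    by (rule sum.swap)
  also have "(\<Sum>a<n. \<Sum>p<n. \<Sum>q<n. gE p q * swapN n m a b (pd p q F) * gY a) - \<dots> = (\<Sum>a<n. swapN n (Suc m) a b F * gY a)"
    by (simp only: swapN_Suc left_diff_distrib sum_distrib_right sum_subtractf)
  finally show ?case .
qed

text \<open>As for \<open>gY_symN\<close>, but the covector passes the rightmost matrix unit, split
  off by \<open>symN_Suc_right\<close>.\<close>

lemma symN_gX:
  assumes "b < n"
  shows "eqm (relsH n \<zeta>) (symN n m F * gX b) (\<Sum>a<n. gX a * swapN n m b a F)"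
  using assms
proof (induction m arbitrary: b F)
  case 0
  have "(\<Sum>a<n. gX a * swapN n 0 b a F) = (\<Sum>a<n. if b = a then gX a * symN n 0 F else 0)"
    by (rule sum.cong) (auto simp: swapN_def)
  also have "\<dots> = symN n 0 F * gX b"
    using 0 by (simp add: sc_commute)
  finally show ?case by simp
next
  case (Suc m)
  let ?R = "relsH n \<zeta>"
  have xE: "eqm ?R (gE p q * gX b) (gX b * gE p q - kd p b * gX q)" if "p < n" "q < n" for p q
    using eqm_add[OF eqm_refl[of _ "gX b * gE p q"] eqm_gE_gX[OF that Suc.prems(1)]] by (simp add: comm_def)
  have "symN n (Suc m) F * gX b = (\<Sum>p<n. \<Sum>q<n. symN n m (pd p q F) * (gE p q * gX b))"
    by (simp add: symN_Suc_right sum_distrib_right mult.assoc del: symN.simps)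
  also have "eqm ?R \<dots> (\<Sum>p<n. \<Sum>q<n. symN n m (pd p q F) * (gX b * gE p q - kd p b * gX q))"
    by (intro eqm_sum eqm_mult_left xE) auto
  also have "\<dots> = (\<Sum>p<n. \<Sum>q<n. symN n m (pd p q F) * gX b * gE p q)
      - (\<Sum>q<n. \<Sum>p<n. kd p b * (symN n m (pd p q F) * gX q))"
    by (subst (2) sum.swap) (simp add: sum_subtractf right_diff_distrib mult.assoc kd_left_commute)
  also have "(\<Sum>q<n. \<Sum>p<n. kd p b * (symN n m (pd p q F) * gX q)) = (\<Sum>q<n. symN n m (pd b q F) * gX q)"
    using Suc.prems by (simp add: sum_kd_right)
  also have "eqm ?R ((\<Sum>p<n. \<Sum>q<n. symN n m (pd p q F) * gX b * gE p q) - (\<Sum>q<n. symN n m (pd b q F) * gX q))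
      ((\<Sum>p<n. \<Sum>q<n. (\<Sum>a<n. gX a * swapN n m b a (pd p q F)) * gE p q) - (\<Sum>q<n. \<Sum>a<n. gX a * swapN n m q a (pd b q F)))"
    using Suc.prems by (intro eqm_diff eqm_sum eqm_mult_right Suc.IH) auto
  also have "(\<Sum>p<n. \<Sum>q<n. (\<Sum>a<n. gX a * swapN n m b a (pd p q F)) * gE p q) =
      (\<Sum>a<n. \<Sum>p<n. \<Sum>q<n. gX a * (swapN n m b a (pd p q F) * gE p q))"
    (is "?l = _")
  proof -
    have "?l = (\<Sum>p<n. \<Sum>a<n. \<Sum>q<n. gX a * (swapN n m b a (pd p q F) * gE p q))"
      by (simp only: sum_distrib_right mult.assoc) (intro sum.cong refl sum.swap)
    also have "\<dots> = (\<Sum>a<n. \<Sum>p<n. \<Sum>q<n. gX a * (swapN n m b a (pd p q F) * gE p q))"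
      by (rule sum.swap)
    finally show ?thesis .
  qed
  also have "(\<Sum>q<n. \<Sum>a<n. gX a * swapN n m q a (pd b q F)) = (\<Sum>a<n. \<Sum>q<n. gX a * swapN n m q a (pd b q F))"
    by (rule sum.swap)
  also have "(\<Sum>a<n. \<Sum>p<n. \<Sum>q<n. gX a * (swapN n m b a (pd p q F) * gE p q)) - \<dots> = (\<Sum>a<n. gX a * swapN n (Suc m) b a F)"
    using Suc.prems by (simp add: swapN_Suc_right right_diff_distrib sum_distrib_left sum_subtractf)
  finally show ?case .
qed

subsection \<open>Invariance\<close>

text \<open>The derivation of S(gl_n) that extends the bracket with e_pq.\<close>

definition ad :: "nat \<Rightarrow> nat \<Rightarrow> nat \<Rightarrow> sg \<Rightarrow> sg" where
  "ad n p q F = (\<Sum>l<n. var p l * pd q l F) - (\<Sum>k<n. var k q * pd k p F)"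

lemma lookup_var_mult_0: "Poly_Mapping.lookup (var p q * F) 0 = 0"
  by (induction F rule: poly_mapping_single_induct)
    (simp_all add: var_def mult_single lookup_single lookup_add when_def algebra_simps)

lemma pd_ad:
  assumes "r < n" "s < n"
  shows "pd r s (ad n p q F) =
    ad n p q (pd r s F) + (if r = p then pd q s F else 0) - (if s = q then pd r p F else 0)"
proof -
  have "(\<Sum>l<n. pd r s (var p l) * pd q l F) = (\<Sum>l<n. if l = s then if r = p then pd q l F else 0 else 0)"
    by (rule sum.cong) (auto simp: pd_var)
  moreover have "(\<Sum>k<n. pd r s (var k q) * pd k p F) = (\<Sum>k<n. if k = r then if s = q then pd k p F else 0 else 0)"
    by (rule sum.cong) (auto simp: pd_var)
  moreover have "pd r s (ad n p q F) = ad n p q (pd r s F)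
      + (\<Sum>l<n. pd r s (var p l) * pd q l F) - (\<Sum>k<n. pd r s (var k q) * pd k p F)"
    by (simp add: ad_def pd_diff pd_sum pd_mult sum.distrib pd_commute[of r s] algebra_simps)
  ultimately show ?thesis using assms by simp
qed

text \<open>Symmetrization is equivariant. The bracket with the first factor yields exactly the
  correction terms by which \<open>pd r s\<close> fails to commute with \<open>ad\<close> in
  \<open>pd_ad\<close>; induction handles the remaining factors.\<close>

lemma comm_gE_symN:
  assumes "p < n" "q < n"
  shows "eqm (relsU n) (comm (gE p q) (symN n m F)) (symN n m (ad n p q F))"
proof (induction m arbitrary: F)
  case 0
  have "Poly_Mapping.lookup (ad n p q F) 0 = 0"
    by (simp add: ad_def lookup_minus lookup_sum lookup_var_mult_0)
  then show ?case by (simp add: comm_def sc_commute)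
next
  case (Suc m)
  have "comm (gE p q) (symN n (Suc m) F) =
      (\<Sum>r<n. \<Sum>s<n. comm (gE p q) (gE r s) * symN n m (pd r s F) + gE r s * comm (gE p q) (symN n m (pd r s F)))"
    by (simp add: comm_sum_right comm_mult_right)
  also have "eqm (relsU n) \<dots> (\<Sum>r<n. \<Sum>s<n. (kd q r * gE p s - kd s p * gE r q) * symN n m (pd r s F)
      + gE r s * symN n m (ad n p q (pd r s F)))"
    using assms by (intro eqm_sum eqm_add eqm_mult_left eqm_mult_right eqm_gE_gE Suc.IH) auto
  also have "\<dots> = (\<Sum>r<n. \<Sum>s<n. kd q r * (gE p s * symN n m (pd r s F)))
      - (\<Sum>r<n. \<Sum>s<n. kd s p * (gE r q * symN n m (pd r s F)))
      + (\<Sum>r<n. \<Sum>s<n. gE r s * symN n m (ad n p q (pd r s F)))"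
    by (simp only: sum.distrib sum_subtractf left_diff_distrib mult.assoc)
  also have "\<dots> = (\<Sum>s<n. gE p s * symN n m (pd q s F)) - (\<Sum>r<n. gE r q * symN n m (pd r p F))
      + (\<Sum>r<n. \<Sum>s<n. gE r s * symN n m (ad n p q (pd r s F)))"
  proof -
    have "(\<Sum>r<n. \<Sum>s<n. kd q r * (gE p s * symN n m (pd r s F))) = (\<Sum>s<n. gE p s * symN n m (pd q s F))"
      using assms by (subst sum.swap) (simp add: sum_kd_left)
    then show ?thesis using assms by (simp add: sum_kd_right)
  qed
  also have "\<dots> = symN n (Suc m) (ad n p q F)"
  proof -
    have "symN n (Suc m) (ad n p q F) = (\<Sum>r<n. \<Sum>s<n. gE r s * symN n m (ad n p q (pd r s F))
        + (if r = p then gE p s * symN n m (pd q s F) else 0) - (if s = q then gE r q * symN n m (pd r p F) else 0))"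
      by (simp only: symN.simps, intro sum.cong refl)
        (simp add: pd_ad symN_add symN_diff algebra_simps)
    also have "\<dots> = (\<Sum>r<n. \<Sum>s<n. gE r s * symN n m (ad n p q (pd r s F)))
        + (\<Sum>r<n. if r = p then \<Sum>s<n. gE p s * symN n m (pd q s F) else 0)
        - (\<Sum>r<n. \<Sum>s<n. if s = q then gE r q * symN n m (pd r p F) else 0)"
      unfolding sum.distrib[symmetric] sum_subtractf[symmetric]
      by (intro sum.cong refl) (simp add: sum.distrib sum_subtractf)
    finally show ?thesis using assms by (simp add: algebra_simps)
  qed
  finally show ?case .
qed

text \<open>The gradient of h_m is a polynomial P in A with scalar coefficients from S(gl_n), so it
  commutes with A. The two sums in \<open>ad\<close> are the \<open>(q, p)\<close> entries of P A
  and A P.\<close>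

lemma ad_hs:
  assumes "p < n" "q < n"
  shows "ad n p q (hs n m) = 0"
proof -
  have "(\<Sum>l<n. var p l * pd q l (hs n m)) = (\<Sum>l<n. \<Sum>k<m. mpow n crd k q l * crd l p * hs n (m - 1 - k))"
    using assms by (simp add: pd_hs pm_def crd_def sum_distrib_left algebra_simps)
  also have "\<dots> = (\<Sum>k<m. mpow n crd (Suc k) q p * hs n (m - 1 - k))"
    using assms by (subst sum.swap) (simp add: mpow_Suc_right sum_distrib_right)
  also have "\<dots> = (\<Sum>l<n. \<Sum>k<m. crd q l * mpow n crd k l p * hs n (m - 1 - k))"
    by (subst sum.swap) (simp add: mpow.simps mmul_def sum_distrib_right)
  also have "\<dots> = (\<Sum>l<n. var l q * pd l p (hs n m))"
    using assms by (simp add: pd_hs pm_def crd_def sum_distrib_left algebra_simps)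
  finally show ?thesis by (simp add: ad_def)
qed

lemma comm_gE_SymTrS:
  assumes "p < n" "q < n"
  shows "eqm (relsU n) (comm (gE p q) (SymTrS n m)) 0"
  using eqm_mult_left[OF comm_gE_symN[OF assms, of m "hs n m"]] assms
  by (simp add: SymTrS_eq comm_sc_mult_right ad_hs)

lemma comm_gE_res_part: "eqm (relsU n) (comm (gE i j) (res_part n f)) 0"
proof (cases "i < n \<and> j < n")
  case True
  have "eqm (relsU n) (comm (gE i j) (res_part n f)) (\<Sum>m\<in>{1..degree f}. sc (gcoef n f m) * 0)"
    unfolding res_part_def comm_sum_right comm_sc_mult_right
    using True by (intro eqm_sum eqm_mult_left comm_gE_SymTrS) auto
  then show ?thesis by simp
next
  case False
  then have "gE i j \<in> tideal (relsU n)"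
    by (intro tideal.base) (unfold relsU_def, blast)
  then show ?thesis
    by (simp add: eqm_zero_iff comm_def tideal_diff tideal_mult_left tideal_mult_right)
qed

subsection \<open>Commutators with the Casimir element\<close>

text \<open>The coefficient of r_j when e^(-D) is applied to h_m: the exponential contributes the
  term with D^(m-j), and the rising factorial comes from \<open>dpow_hs\<close>.\<close>

definition swap_coef :: "nat \<Rightarrow> nat \<Rightarrow> nat \<Rightarrow> complex" where
  "swap_coef n m j = (- 1) ^ (m - j) / fact (m - j) * pochhammer (of_nat (Suc j + n)) (m - j - 1)"

text \<open>The term k = 0 is the undisturbed trace on the diagonal. The term k = m - j lowers the
  degree to j and is a multiple of r_j by \<open>dpow_hs\<close>; the binomial and the
  normalizations 1/m! and j! combine to 1/(m-j)!.\<close>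

lemma swapN_hs:
  assumes "a < n" "b < n"
  shows "sc (1 / fact m) * swapN n m a b (hs n m) =
    (if a = b then SymTrS n m else 0) + (\<Sum>j<m. sc (swap_coef n m j) * r_el n j b a)"
proof -
  define T where "T k = sc (1 / fact m) * symN n (m - k) (cst ((- 1) ^ k * of_nat (m choose k)) * dpow n k a b (hs n m))" for k
  have "sc (1 / fact m) * swapN n m a b (hs n m) = (\<Sum>k\<le>m. T k)"
    by (simp only: swapN_def T_def sum_distrib_left)
  also have "\<dots> = T 0 + (\<Sum>k<m. T (Suc k))"
    by (simp only: lessThan_Suc_atMost[symmetric] sum.lessThan_Suc_shift)
  also have "T 0 = (if a = b then SymTrS n m else 0)"
    by (simp add: T_def SymTrS_eq)
  also have "(\<Sum>k<m. T (Suc k)) = (\<Sum>j<m. T (m - j))"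
    by (rule sum.reindex_bij_witness[of _ "\<lambda>j. m - Suc j" "\<lambda>k. m - Suc k"]) auto
  also have "\<dots> = (\<Sum>j<m. sc (swap_coef n m j) * r_el n j b a)"
  proof (rule sum.cong[OF refl])
    fix j assume j: "j \<in> {..<m}"
    define k where "k = m - j - 1"
    have k: "m - j = Suc k" "m = k + Suc j" "j = m - Suc k" using j by (simp_all add: k_def)
    have "dpow n (Suc k) a b (hs n m) = cst (pochhammer (of_nat (Suc j + n)) k) * pm n (Suc j) a b"
      using dpow_hs[OF assms, of k "Suc j"] by (simp only: k(2))
    then have "T (m - j) = sc (1 / fact m * ((- 1) ^ Suc k * of_nat (m choose Suc k) * pochhammer (of_nat (Suc j + n)) k))
        * symN n j (pm n (Suc j) a b)"
      unfolding T_def k(1) k(3)[symmetric] by (simp only: symN_cst_mult mult.assoc sc_mult)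
    also have "symN n j (pm n (Suc j) a b) = sc (fact j) * r_el n j b a"
      by (simp add: r_el_eq[OF assms] mult.assoc[symmetric] sc_mult[symmetric])
    also have "sc (1 / fact m * ((- 1) ^ Suc k * of_nat (m choose Suc k) * pochhammer (of_nat (Suc j + n)) k)) * \<dots> =
        sc (1 / fact m * ((- 1) ^ Suc k * of_nat (m choose Suc k) * pochhammer (of_nat (Suc j + n)) k) * fact j) * r_el n j b a"
      by (simp only: sc_mult mult.assoc)
    also have "1 / fact m * ((- 1) ^ Suc k * of_nat (m choose Suc k) * pochhammer (of_nat (Suc j + n)) k) * fact j =
        swap_coef n m j"
    proof -
      have "of_nat (m choose Suc k) = (fact m / (fact (Suc k) * fact j) :: complex)"
        using binomial_fact[of "Suc k" m, where ?'a = complex] j by (simp add: k_def del: fact_Suc)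
      then show ?thesis by (simp add: swap_coef_def k(1) del: fact_Suc power_Suc of_nat_Suc of_nat_add)
    qed
    finally show "T (m - j) = sc (swap_coef n m j) * r_el n j b a" .
  qed
  finally show ?thesis .
qed

lemma gY_SymTrS:
  assumes "b < n"
  shows "eqm (relsH n \<zeta>) (gY b * SymTrS n m)
    (SymTrS n m * gY b + (\<Sum>a<n. (\<Sum>j<m. sc (swap_coef n m j) * r_el n j b a) * gY a))"
proof -
  have "gY b * SymTrS n m = sc (1 / fact m) * (gY b * symN n m (hs n m))"
    by (simp add: SymTrS_eq sc_left_commute)
  also have "eqm (relsH n \<zeta>) \<dots> (sc (1 / fact m) * (\<Sum>a<n. swapN n m a b (hs n m) * gY a))"
    by (intro eqm_mult_left gY_symN assms)
  also have "\<dots> = (\<Sum>a<n. (if a = b then SymTrS n m * gY a else 0)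
      + (\<Sum>j<m. sc (swap_coef n m j) * r_el n j b a) * gY a)"
    using assms unfolding sum_distrib_left mult.assoc[symmetric]
    by (intro sum.cong refl) (simp add: swapN_hs distrib_right)
  also have "\<dots> = SymTrS n m * gY b + (\<Sum>a<n. (\<Sum>j<m. sc (swap_coef n m j) * r_el n j b a) * gY a)"
    using assms by (simp add: sum.distrib)
  finally show ?thesis .
qed

lemma SymTrS_gX:
  assumes "b < n"
  shows "eqm (relsH n \<zeta>) (SymTrS n m * gX b)
    (gX b * SymTrS n m + (\<Sum>a<n. gX a * (\<Sum>j<m. sc (swap_coef n m j) * r_el n j a b)))"
proof -
  have "SymTrS n m * gX b = sc (1 / fact m) * (symN n m (hs n m) * gX b)"
    by (simp add: SymTrS_eq mult.assoc)
  also have "eqm (relsH n \<zeta>) \<dots> (sc (1 / fact m) * (\<Sum>a<n. gX a * swapN n m b a (hs n m)))"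
    by (intro eqm_mult_left symN_gX assms)
  also have "\<dots> = (\<Sum>a<n. gX a * (sc (1 / fact m) * swapN n m b a (hs n m)))"
    by (simp only: sum_distrib_left sc_left_commute)
  also have "\<dots> = (\<Sum>a<n. (if b = a then gX a * SymTrS n m else 0)
      + gX a * (\<Sum>j<m. sc (swap_coef n m j) * r_el n j a b))"
    using assms by (intro sum.cong refl) (simp add: swapN_hs distrib_left)
  also have "\<dots> = gX b * SymTrS n m + (\<Sum>a<n. gX a * (\<Sum>j<m. sc (swap_coef n m j) * r_el n j a b))"
    using assms by (simp add: sum.distrib)
  finally show ?thesis .
qed

subsection \<open>The difference equation for f\<close>

lemma coeff_pcompose_shift:
  fixes f :: "complex poly"
  shows "coeff (pcompose f [:-1, 1:]) j = (\<Sum>m\<in>{j..degree f}. coeff f m * (of_nat (m choose j) * (- 1) ^ (m - j)))"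
proof -
  have "coeff ([:-1, 1:] ^ m) j = (if j \<le> m then of_nat (m choose j) * (- 1) ^ (m - j) else (0 :: complex))" for m
  proof (cases "j \<le> m")
    case False
    then show ?thesis by (auto intro!: coeff_eq_0 simp: degree_linear_power)
  qed (simp add: coeff_linear_poly_power)
  then have "coeff (pcompose f [:-1, 1:]) j =
      (\<Sum>m\<le>degree f. if j \<le> m then coeff f m * (of_nat (m choose j) * (- 1) ^ (m - j)) else 0)"
    unfolding pcompose_altdef poly_altdef
    by (simp add: degree_map_poly coeff_map_poly coeff_sum) (intro sum.cong refl, simp)
  also have "\<dots> = (\<Sum>m\<in>{j..degree f}. coeff f m * (of_nat (m choose j) * (- 1) ^ (m - j)))"
    by (intro sum.mono_neutral_cong_right) auto
  finally show ?thesis .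
qed

text \<open>The denominator of g_m equals (m+n-1)!/m! and the rising factorial in
  \<open>swap_coef\<close> equals (m+n-1)!/(j+n)!. Cancelling (m+n-1)! leaves a binomial coefficient
  of f(z-1).\<close>

lemma gcoef_swap_coef:
  assumes "n \<ge> 1" "j < m"
  shows "gcoef n f m * swap_coef n m j =
    coeff f m * (of_nat (m choose j) * (- 1) ^ (m - j)) / pochhammer (of_nat (Suc j)) n"
proof -
  have P: "pochhammer (of_nat (Suc i)) k = (fact (i + k) / fact i :: complex)" for i k
    using pochhammer_product'[of "1::complex" i k] by (simp add: pochhammer_fact[symmetric])
  obtain n' where n: "n = Suc n'" using assms by (cases n) auto
  have 1: "pochhammer (of_nat (m + 1)) (n - 1) = (fact (m + n - 1) / fact m :: complex)"
    using P[of m "n - 1"] n by simp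
  have 2: "pochhammer (of_nat (Suc j + n)) (m - j - 1) = (fact (m + n - 1) / fact (j + n) :: complex)"
  proof -
    have "j + n + (m - j - 1) = m + n - 1" using assms by simp
    then show ?thesis using P[of "j + n" "m - j - 1"] by (simp only: add_Suc)
  qed
  have 3: "of_nat (m choose j) = (fact m / (fact j * fact (m - j)) :: complex)"
    using binomial_fact[of j m, where ?'a = complex] assms by simp
  show ?thesis
    unfolding gcoef_def swap_coef_def 1 2 3 P by (simp add: field_simps)
qed

text \<open>Compare coefficients of z^j in the difference equation: f_j cancels on the left, and the
  n-th derivative of z^n zeta(z) contributes (j+1)...(j+n) zeta_j, whose factor is the remaining
  denominator in \<open>gcoef_swap_coef\<close>.\<close>

lemma sum_gcoef_swap_coef:
  assumes n: "n \<ge> 1" and f: "f - pcompose f [:-1, 1:] = (pderiv ^^ n) (monom 1 n * \<zeta>)"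
  shows "(\<Sum>m\<in>{Suc j..degree f}. gcoef n f m * swap_coef n m j) = - coeff \<zeta> j"
proof -
  let ?t = "\<lambda>m. coeff f m * (of_nat (m choose j) * (- 1) ^ (m - j))"
  have nz: "pochhammer (of_nat (Suc j)) n \<noteq> (0 :: complex)"
    by (auto simp: pochhammer_eq_0_iff simp flip: of_nat_Suc)
      (metis add_eq_0_iff_both_eq_0 of_nat_add of_nat_eq_0_iff nat.distinct(1) add.commute eq_neg_iff_add_eq_0)
  have "coeff (pcompose f [:-1, 1:]) j = coeff f j + (\<Sum>m\<in>{Suc j..degree f}. ?t m)"
  proof (cases "j \<le> degree f")
    case True
    then have "{j..degree f} = insert j {Suc j..degree f}" by auto
    then show ?thesis by (simp add: coeff_pcompose_shift)
  qed (simp add: coeff_pcompose_shift coeff_eq_0)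
  moreover have "coeff f j - coeff (pcompose f [:-1, 1:]) j = pochhammer (of_nat (Suc j)) n * coeff \<zeta> j"
    unfolding coeff_diff[symmetric] f coeff_higher_pderiv by (simp add: coeff_monom_mult)
  ultimately have "- (\<Sum>m\<in>{Suc j..degree f}. ?t m) = pochhammer (of_nat (Suc j)) n * coeff \<zeta> j"
    by simp
  then have "(\<Sum>m\<in>{Suc j..degree f}. ?t m) = - (pochhammer (of_nat (Suc j)) n * coeff \<zeta> j)"
    by (metis minus_minus)
  then show ?thesis
    using nz by (simp add: gcoef_swap_coef[OF n] sum_divide_distrib[symmetric] del: of_nat_Suc)
qed

text \<open>The family \<open>r\<close> is arbitrary because the identity serves both index orders
  of \<open>r_el\<close>, for vectors and for covectors.\<close>

lemma sum_gcoef_r: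
  assumes n: "n \<ge> 1" and f: "f - pcompose f [:-1, 1:] = (pderiv ^^ n) (monom 1 n * \<zeta>)"
  shows "(\<Sum>m\<in>{1..degree f}. sc (gcoef n f m) * (\<Sum>j<m. sc (swap_coef n m j) * r j)) =
    - (\<Sum>j\<le>degree \<zeta>. sc (coeff \<zeta> j) * r j)"
proof -
  \<comment> \<open>The sum over \<open>m\<close> is empty for such \<open>j\<close>; this
    reconciles the ranges given by the degrees of \<open>f\<close> and
    \<open>\<zeta>\<close>.\<close>
  have z: "coeff \<zeta> j = 0" if "j \<ge> degree f" for j
    using sum_gcoef_swap_coef[OF n f, of j] that by simp
  have "(\<Sum>m\<in>{1..degree f}. sc (gcoef n f m) * (\<Sum>j<m. sc (swap_coef n m j) * r j)) =
      (\<Sum>m\<in>{1..degree f}. \<Sum>j<m. sc (gcoef n f m * swap_coef n m j) * r j)"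
    by (simp add: sum_distrib_left sc_mult mult.assoc)
  also have "\<dots> = (\<Sum>j<degree f. \<Sum>m\<in>{Suc j..degree f}. sc (gcoef n f m * swap_coef n m j) * r j)"
    by (simp add: sum.Sigma) (rule sum.reindex_bij_witness[of _ prod.swap prod.swap]; auto)
  also have "\<dots> = (\<Sum>j<degree f. sc (- coeff \<zeta> j) * r j)"
    by (simp only: sum_distrib_right[symmetric] sc_sum[symmetric] sum_gcoef_swap_coef[OF n f])
  also have "\<dots> = - (\<Sum>j<degree f. sc (coeff \<zeta> j) * r j)"
    by (simp add: sc_uminus sum_negf)
  also have "(\<Sum>j<degree f. sc (coeff \<zeta> j) * r j) = (\<Sum>j\<le>degree f + degree \<zeta>. sc (coeff \<zeta> j) * r j)"
    by (rule sum.mono_neutral_left) (auto simp: z)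
  also have "\<dots> = (\<Sum>j\<le>degree \<zeta>. sc (coeff \<zeta> j) * r j)"
    by (rule sum.mono_neutral_right) (auto simp: coeff_eq_0)
  finally show ?thesis .
qed

definition bracket :: "nat \<Rightarrow> complex poly \<Rightarrow> nat \<Rightarrow> nat \<Rightarrow> fa" where
  "bracket n \<zeta> b a = (\<Sum>j\<le>degree \<zeta>. sc (coeff \<zeta> j) * r_el n j b a)"

lemma comm_gY_res_part:
  assumes n: "n \<ge> 1" and f: "f - pcompose f [:-1, 1:] = (pderiv ^^ n) (monom 1 n * \<zeta>)" and b: "b < n"
  shows "eqm (relsH n \<zeta>) (comm (gY b) (res_part n f)) (- (\<Sum>a<n. bracket n \<zeta> b a * gY a))"
proof -
  let ?S = "\<lambda>m a. (\<Sum>j<m. sc (swap_coef n m j) * r_el n j b a)"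
  have "comm (gY b) (res_part n f) =
      (\<Sum>m\<in>{1..degree f}. sc (gcoef n f m) * (gY b * SymTrS n m - SymTrS n m * gY b))"
    by (simp only: res_part_def comm_sum_right comm_sc_mult_right) (simp only: comm_def)
  also have "eqm (relsH n \<zeta>) \<dots> (\<Sum>m\<in>{1..degree f}. sc (gcoef n f m) *
      (SymTrS n m * gY b + (\<Sum>a<n. ?S m a * gY a) - SymTrS n m * gY b))"
    by (intro eqm_sum eqm_mult_left eqm_diff gY_SymTrS b eqm_refl)
  also have "\<dots> = (\<Sum>m\<in>{1..degree f}. \<Sum>a<n. sc (gcoef n f m) * ?S m a * gY a)"
    unfolding add_diff_cancel_left' mult.assoc by (rule sum.cong[OF refl], rule sum_distrib_left)
  also have "\<dots> = (\<Sum>a<n. (\<Sum>m\<in>{1..degree f}. sc (gcoef n f m) * ?S m a) * gY a)"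
    by (subst sum.swap) (intro sum.cong refl sum_distrib_right[symmetric])
  also have "\<dots> = - (\<Sum>a<n. bracket n \<zeta> b a * gY a)"
    by (simp only: sum_gcoef_r[OF n f]) (simp add: bracket_def sum_negf)
  finally show ?thesis .
qed

text \<open>The sign is opposite to the case of \<open>gY\<close>, because here the symmetrized
  product starts on the left of the generator that is moved.\<close>

lemma comm_gX_res_part:
  assumes n: "n \<ge> 1" and f: "f - pcompose f [:-1, 1:] = (pderiv ^^ n) (monom 1 n * \<zeta>)" and b: "b < n"
  shows "eqm (relsH n \<zeta>) (comm (gX b) (res_part n f)) (\<Sum>a<n. gX a * bracket n \<zeta> a b)"
proof -
  let ?S = "\<lambda>m a. (\<Sum>j<m. sc (swap_coef n m j) * r_el n j a b)"
  have "comm (gX b) (res_part n f) =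
      (\<Sum>m\<in>{1..degree f}. sc (gcoef n f m) * (gX b * SymTrS n m - SymTrS n m * gX b))"
    by (simp only: res_part_def comm_sum_right comm_sc_mult_right) (simp only: comm_def)
  also have "eqm (relsH n \<zeta>) \<dots> (\<Sum>m\<in>{1..degree f}. sc (gcoef n f m) *
      (gX b * SymTrS n m - (gX b * SymTrS n m + (\<Sum>a<n. gX a * ?S m a))))"
    by (intro eqm_sum eqm_mult_left eqm_diff SymTrS_gX b eqm_refl)
  also have "\<dots> = - (\<Sum>m\<in>{1..degree f}. \<Sum>a<n. gX a * (sc (gcoef n f m) * ?S m a))"
  proof -
    have "sc c * (z - (z + (\<Sum>a<n. gX a * s a))) = - (\<Sum>a<n. gX a * (sc c * s a))" for c z s
      by (simp add: sc_left_commute sum_distrib_left)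
    then show ?thesis by (simp only: sum_negf)
  qed
  also have "\<dots> = - (\<Sum>a<n. gX a * (\<Sum>m\<in>{1..degree f}. sc (gcoef n f m) * ?S m a))"
    by (subst sum.swap) (intro arg_cong[of _ _ uminus] sum.cong refl sum_distrib_left[symmetric])
  also have "\<dots> = (\<Sum>a<n. gX a * bracket n \<zeta> a b)"
    by (simp only: sum_gcoef_r[OF n f]) (simp add: bracket_def sum_negf)
  finally show ?thesis .
qed

text \<open>As the y commute, the sum of the x_a y_a contributes only [y_b, x_a] y_a, and
  \<open>comm_gY_res_part\<close> supplies the negative.\<close>

lemma comm_gY_casimir:
  assumes "n \<ge> 1" "f - pcompose f [:-1, 1:] = (pderiv ^^ n) (monom 1 n * \<zeta>)" "b < n"
  shows "eqm (relsH n \<zeta>) (comm (gY b) (casimir n f)) 0"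
proof -
  have "comm (gY b) (casimir n f) =
      (\<Sum>a<n. comm (gY b) (gX a) * gY a + gX a * comm (gY b) (gY a)) + comm (gY b) (res_part n f)"
    by (simp add: casimir_def comm_add_right comm_sum_right comm_mult_right)
  also have "eqm (relsH n \<zeta>) \<dots> ((\<Sum>a<n. bracket n \<zeta> b a * gY a + gX a * 0) + - (\<Sum>a<n. bracket n \<zeta> b a * gY a))"
    using assms unfolding bracket_def
    by (intro eqm_add eqm_sum eqm_mult_left eqm_mult_right eqm_gY_gX eqm_gY_gY
        comm_gY_res_part[unfolded bracket_def]) auto
  finally show ?thesis by simp
qed

lemma comm_gX_casimir:
  assumes "n \<ge> 1" "f - pcompose f [:-1, 1:] = (pderiv ^^ n) (monom 1 n * \<zeta>)" "b < n"
  shows "eqm (relsH n \<zeta>) (comm (gX b) (casimir n f)) 0"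
proof -
  have XY: "eqm (relsH n \<zeta>) (comm (gX b) (gY a)) (- bracket n \<zeta> a b)" if "a < n" for a
    using eqm_uminus[OF eqm_gY_gX[OF \<open>b < n\<close> that, of \<zeta>]] by (simp add: comm_def bracket_def)
  have "comm (gX b) (casimir n f) =
      (\<Sum>a<n. comm (gX b) (gX a) * gY a + gX a * comm (gX b) (gY a)) + comm (gX b) (res_part n f)"
    by (simp add: casimir_def comm_add_right comm_sum_right comm_mult_right)
  also have "eqm (relsH n \<zeta>) \<dots> ((\<Sum>a<n. 0 * gY a + gX a * (- bracket n \<zeta> a b)) + (\<Sum>a<n. gX a * bracket n \<zeta> a b))"
    using assms
    by (intro eqm_add eqm_sum eqm_mult_left eqm_mult_right eqm_gX_gX XY comm_gX_res_part) auto
  finally show ?thesis by (simp add: sum_negf)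
qed

text \<open>The pairing of dual bases is invariant: its two contributions are
  \<open>gX j * gY i\<close> with opposite signs.\<close>

lemma comm_gE_casimir:
  assumes "i < n" "j < n"
  shows "eqm (relsH n \<zeta>) (comm (gE i j) (casimir n f)) 0"
proof -
  have "comm (gE i j) (casimir n f) =
      (\<Sum>a<n. comm (gE i j) (gX a) * gY a + gX a * comm (gE i j) (gY a)) + comm (gE i j) (res_part n f)"
    by (simp add: casimir_def comm_add_right comm_sum_right comm_mult_right)
  also have "eqm (relsH n \<zeta>) \<dots> ((\<Sum>a<n. - (kd i a * gX j) * gY a + gX a * (kd j a * gY i)) + 0)"
    using assms
    by (intro eqm_add eqm_sum eqm_mult_left eqm_mult_right eqm_gE_gX eqm_gE_gY
        eqm_mono[OF _ comm_gE_res_part]) (auto simp: relsH_def)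
  also have "\<dots> = - (\<Sum>a<n. kd i a * (gX j * gY a)) + (\<Sum>a<n. kd j a * (gX a * gY i))"
    by (simp add: sum.distrib sum_subtractf sum_negf kd_left_commute mult.assoc)
  also have "\<dots> = 0"
    using assms by (simp add: sum_kd_left)
  finally show ?thesis .
qed

section \<open>From generators to the whole algebra\<close>

lemma comm_generator_casimir:
  assumes "n \<ge> 1" "f - pcompose f [:-1, 1:] = (pderiv ^^ n) (monom 1 n * \<zeta>)"
  shows "eqm (relsH n \<zeta>) (comm (Poly_Mapping.single (Word [g]) 1) (casimir n f)) 0"
proof -
  \<comment> \<open>Generators with an index out of range are themselves relations, so they commute
    with everything modulo the ideal.\<close>
  have zero: "eqm (relsH n \<zeta>) (comm x (casimir n f)) 0" if "x \<in> relsH n \<zeta>" for x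
    using tideal.base[OF that]
    by (simp add: eqm_zero_iff comm_def tideal_diff tideal_mult_left tideal_mult_right)
  show ?thesis
  proof (cases g)
    case (Eg i j)
    have "eqm (relsH n \<zeta>) (comm (gE i j) (casimir n f)) 0"
    proof (cases "i < n \<and> j < n")
      case False
      then show ?thesis by (intro zero) (unfold relsH_def relsU_def, blast)
    qed (simp add: comm_gE_casimir)
    then show ?thesis by (simp add: Eg gE_def)
  next
    case (Xg i)
    have "eqm (relsH n \<zeta>) (comm (gX i) (casimir n f)) 0"
    proof (cases "i < n")
      case False
      then have "n \<le> i" by simp
      then show ?thesis by (intro zero) (unfold relsH_def, blast)
    qed (simp add: comm_gX_casimir assms)
    then show ?thesis by (simp add: Xg gX_def)
  next
    case (Yg i)
    have "eqm (relsH n \<zeta>) (comm (gY i) (casimir n f)) 0"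
    proof (cases "i < n")
      case False
      then have "n \<le> i" by simp
      then show ?thesis by (intro zero) (unfold relsH_def, blast)
    qed (simp add: comm_gY_casimir assms)
    then show ?thesis by (simp add: Yg gY_def)
  qed
qed

text \<open>Commuting with \<open>z\<close> modulo the ideal passes to sums and, by the Leibniz
  rule, to products; the empty word gives the scalars.\<close>

lemma comm_eqm_zero_generators:
  assumes gen: "\<And>g. eqm R (comm (Poly_Mapping.single (Word [g]) 1) z) 0"
  shows "eqm R (comm h z) 0"
proof (induction h rule: poly_mapping_single_induct)
  case (single w c)
  have "eqm R (comm (Poly_Mapping.single (Word gs) c) z) 0" for gs
  proof (induction gs)
    case Nil
    have "Poly_Mapping.single (Word []) c = sc c" by (simp add: sc_def zero_word_def)
    then show ?case by simp
  next
    case (Cons g gs)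
    have "Poly_Mapping.single (Word (g # gs)) c = Poly_Mapping.single (Word [g]) 1 * Poly_Mapping.single (Word gs) c"
      by (simp add: mult_single plus_word_def)
    then show ?case
      using eqm_add[OF eqm_mult_left[OF Cons.IH] eqm_mult_right[OF gen]]
      by (simp add: comm_mult_left)
  qed
  then show ?case by (cases w) simp
next
  case (add F G)
  then show ?case using eqm_add by (fastforce simp: comm_add_left)
qed

text \<open>The first part works modulo \<open>relsU\<close> because the correction to t_1 has to be
  central in U(gl_n) itself; the second is centrality of the sum in H_zeta(gl_n).\<close>

theorem theorem3p2:
  fixes n :: nat and \<zeta> f :: "complex poly"
  assumes "n \<ge> 1"
    and "poly f 0 = 0"
    and "f - pcompose f [:-1, 1:] = (pderiv ^^ n) (monom 1 n * \<zeta>)"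
  shows "(\<forall>i j. comm (gE i j) (res_part n f) \<in> tideal (relsU n))
       \<and> (\<forall>h. comm h (casimir n f) \<in> tideal (relsH n \<zeta>))"
  using comm_gE_res_part comm_eqm_zero_generators[OF comm_generator_casimir[OF assms(1,3)]]
  by (simp add: eqm_zero_iff)

end
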